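(* Let $\varepsilon_0^d=\sqrt2\log 2$ and, for $0\le\varepsilon<\varepsilon_0^d$, let $$C^d(\varepsilon)=\frac{e^{-\varepsilon/\sqrt2}}{2-e^{\varepsilon/\sqrt2}}.$$ Then for every bounded interval $I$, every $0\le\varepsilon<\varepsilon_0^d$ and every $\varphi\in \mathrm{BMO}^d_{\varepsilon}(I)$, $$\langle e^\varphi\rangle_I\le C^d(\varepsilon)\,e^{\langle\varphi\rangle_I}.$$ Moreover, $\varepsilon^d_0$ and $C^d(\varepsilon)$ are sharp: $\varepsilon_0^d=\sqrt2\log2$ is the largest number such that for every $0\le\varepsilon<\varepsilon_0^d$ there is a finite constant $C$ with $\langle e^\varphi\rangle_I\le C e^{\langle\varphi\rangle_I}$ for all $\varphi\in\mathrm{BMO}^d_\varepsilon(I)$; and for each $0\le\varepsilon<\sqrt2\log2$, $C^d(\varepsilon)$ is the smallest constant for which this inequality holds for all $\varphi\in\mathrm{BMO}^d_\varepsilon(I)$.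
   Context: For a bounded interval $J\subset\mathbb{R}$ of positive length, $\langle\varphi\rangle_J=\frac1{|J|}\int_J\varphi$. For an interval $I$, the dyadic lattice rooted in $I$ is the collection of intervals obtained from $I$ by repeatedly splitting intervals into two halves of equal length ($I$ itself included). $\mathrm{BMO}^d(I)$ is the set of real-valued $\varphi\in L^1(I)$ with $$\|\varphi\|_{\mathrm{BMO}^d(I)}=\Bigl(\sup_{J}\bigl\{\langle\varphi^2\rangle_J-\langle\varphi\rangle_J^2\bigr\}\Bigr)^{1/2}<\infty,$$ the supremum being over all intervals $J$ of the dyadic lattice rooted in $I$. For $\varepsilon\ge0$, $\mathrm{BMO}^d_\varepsilon(I)=\{\varphi\in\mathrm{BMO}^d(I):\|\varphi\|_{\mathrm{BMO}^d(I)}\le\varepsilon\}$. *)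

theory Defs
  imports "HOL-Analysis.Analysis"
begin

definition bounded_interval :: "real set \<Rightarrow> bool" where
  "bounded_interval J \<longleftrightarrow> is_interval J \<and> bounded J \<and> 0 < measure lebesgue J"

text \<open>Endpoints may be included or excluded: the interval is split at its midpoint, and the
  midpoint is assigned to the right half (a null-set convention).\<close>

definition midpoint_of :: "real set \<Rightarrow> real" where
  "midpoint_of J = (Inf J + Sup J) / 2"

inductive_set dyadic_lattice :: "real set \<Rightarrow> real set set" for I :: "real set" where
  root: "I \<in> dyadic_lattice I"
| left_half: "J \<in> dyadic_lattice I \<Longrightarrow> J \<inter> {..<midpoint_of J} \<in> dyadic_lattice I"
| right_half: "J \<in> dyadic_lattice I \<Longrightarrow> J \<inter> {midpoint_of J..} \<in> dyadic_lattice I"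

definition average :: "real set \<Rightarrow> (real \<Rightarrow> real) \<Rightarrow> real" where
  "average J f = (LINT x:J|lebesgue. f x) / measure lebesgue J"

text \<open>The Bochner integral of a non-integrable function is \<open>0\<close>. Averages of nonnegative
  functions that are not known to be integrable, such as the square or the exponential of an
  \<open>L\<^sup>1\<close> function, are therefore taken with values in \<open>[0, \<infinity>]\<close>.\<close>

definition nn_average :: "real set \<Rightarrow> (real \<Rightarrow> real) \<Rightarrow> ennreal" where
  "nn_average J f = (\<integral>\<^sup>+x\<in>J. ennreal (f x) \<partial>lebesgue) / emeasure lebesgue J"

definition oscillation :: "real set \<Rightarrow> (real \<Rightarrow> real) \<Rightarrow> ereal" where
  "oscillation J \<phi> = enn2ereal (nn_average J (\<lambda>x. (\<phi> x)\<^sup>2)) - ereal ((average J \<phi>)\<^sup>2)"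

definition sup_oscillation :: "real set \<Rightarrow> (real \<Rightarrow> real) \<Rightarrow> ereal" where
  "sup_oscillation I \<phi> = (SUP J\<in>dyadic_lattice I. oscillation J \<phi>)"

text \<open>Elements of \<open>L\<^sup>1(I)\<close> are represented by functions on the whole line; only their values
  on \<open>I\<close> matter.\<close>

definition BMOd :: "real set \<Rightarrow> (real \<Rightarrow> real) set" where
  "BMOd I = {\<phi>. set_integrable lebesgue I \<phi> \<and> sup_oscillation I \<phi> < \<infinity>}"

definition norm_BMOd :: "real set \<Rightarrow> (real \<Rightarrow> real) \<Rightarrow> real" where
  "norm_BMOd I \<phi> = sqrt (real_of_ereal (sup_oscillation I \<phi>))"

definition BMOd_ball :: "real set \<Rightarrow> real \<Rightarrow> (real \<Rightarrow> real) set" where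
  "BMOd_ball I \<epsilon> = {\<phi> \<in> BMOd I. norm_BMOd I \<phi> \<le> \<epsilon>}"

definition eps0d :: real where
  "eps0d = sqrt 2 * ln 2"

definition Cd :: "real \<Rightarrow> real" where
  "Cd \<epsilon> = exp (- \<epsilon> / sqrt 2) / (2 - exp (\<epsilon> / sqrt 2))"

definition exp_inequality :: "real set \<Rightarrow> real \<Rightarrow> real \<Rightarrow> bool" where
  "exp_inequality I \<epsilon> C \<longleftrightarrow>
    (\<forall>\<phi>\<in>BMOd_ball I \<epsilon>.
      nn_average I (\<lambda>x. exp (\<phi> x)) \<le> ennreal (C * exp (average I \<phi>)))"

end

(* Let c = eps / sqrt 2 and G(p) = e^p (2 - e^p) = 1 - (e^p - 1)^2. For a dyadic interval J with mean
   m and variance 2 (c^2 - p^2), put B(J) = e^m G(p). When J is split, the values q, r of p on the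
   halves satisfy q^2 + r^2 = 2 p^2 + h^2, where 2 h is the difference of the means, and
   e^h G(q) + e^{-h} G(r) <= 2 G(p), so the average of B over the dyadic generations does not
   increase. As G decreases and p <= c, the exponential of the conditional expectations of phi has
   average at most e^m / G(c) = C^d(eps) e^m; pass to the limit with Fatou's lemma.
   The two-point inequality rests on the convexity of (e^x - 1)^2 as a function of x^2.
   Equality holds for phi = c k on the k-th of the right halves obtained by repeatedly halving the
   leftmost interval: every leftmost interval has variance 2 c^2, and <e^phi> = 1 / (2 - e^c). *)

theory Submission
  imports Defs "HOL-Real_Asymp.Real_Asymp"
begin

section \<open>The two-point inequality\<close>

text \<open>The extremal function dictates G. The split of each of its leftmost intervals has p = q
  = 0 and r = h = c. Equality there for every c reads exp h G(0) + exp (-h) G(h) = 2 G(0), and with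
  G(0) = 1 this forces G(h) = exp h (2 - exp h). Measuring the variance through p removes c from the
  two-point inequality: c enters only through p \<le> c and G(c) > 0.

  Local concavity of the Bellman function would not be enough. Along the segment joining the data of
  the two halves the variance is strictly concave if h \<noteq> 0, so between two points of variance
  2 c^2 it exceeds 2 c^2; the whole interval and the left half of the extremal split are two such
  points. Hence jumps h of every size must be treated directly. A Lagrange multiplier for q^2 + r^2
  = 2 p^2 + h^2 decouples q from r, and convexity in x^2 settles each one-variable problem. The
  multiplier is the slope at p while h < 2 p, and the one suited to the extremal split once h \<ge>
  2 p.\<close>

lemma exp_minus_one_le: "exp x - 1 \<le> x * exp (x::real)"
proof -
  have "exp x * (1 + (-x)) \<le> exp x * exp (-x)"
    by (intro mult_left_mono exp_ge_add_one_self) auto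
  then show ?thesis by (simp add: exp_minus algebra_simps)
qed

text \<open>Divided by \<open>2 * (exp x + 1)\<close> this is tanh(x/2) \<le> x/2.\<close>

lemma exp_pade_bound:
  fixes x :: real
  assumes "0 \<le> x"
  shows "2 * (exp x - 1) \<le> x * (exp x + 1)"
proof -
  let ?f = "\<lambda>x::real. x * (exp x + 1) - 2 * (exp x - 1)"
  have "?f 0 \<le> ?f x"
  proof (rule DERIV_nonneg_imp_nondecreasing[OF assms])
    fix y :: real
    have "DERIV ?f y :> 1 + y * exp y - exp y"
      by (auto intro!: derivative_eq_intros simp: algebra_simps)
    moreover have "1 + y * exp y - exp y \<ge> 0"
      using exp_minus_one_le[of y] by simp
    ultimately show "\<exists>d. DERIV ?f y :> d \<and> 0 \<le> d" by blast
  qed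
  then show ?thesis by simp
qed

text \<open>Divided by \<open>2 * exp x\<close> this is x \<le> sinh x.\<close>

lemma exp_sinh_bound:
  fixes x :: real
  assumes "0 \<le> x"
  shows "2 * x * exp x \<le> (exp x)\<^sup>2 - 1"
proof -
  let ?f = "\<lambda>x::real. (exp x)\<^sup>2 - 1 - 2 * x * exp x"
  have "?f 0 \<le> ?f x"
  proof (rule DERIV_nonneg_imp_nondecreasing[OF assms])
    fix y :: real
    have "DERIV ?f y :> 2 * exp y * (exp y - 1 - y)"
      by (auto intro!: derivative_eq_intros simp: algebra_simps power2_eq_square)
    moreover have "2 * exp y * (exp y - 1 - y) \<ge> 0"
      using exp_ge_add_one_self[of y] exp_ge_zero[of y] by (intro mult_nonneg_nonneg) linarith+
    ultimately show "\<exists>d. DERIV ?f y :> d \<and> 0 \<le> d" by blast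
  qed
  then show ?thesis by simp
qed

lemma expm1_over_mono:
  fixes x y :: real
  assumes "0 < x" "x \<le> y"
  shows "(exp x - 1) / x \<le> (exp y - 1) / y"
proof (rule DERIV_nonneg_imp_nondecreasing[OF assms(2)])
  fix z :: real assume "x \<le> z" "z \<le> y"
  then have z: "z > 0" using assms by simp
  then have "DERIV (\<lambda>z. (exp z - 1) / z) z :> (z * exp z - (exp z - 1)) / z\<^sup>2"
    by (auto intro!: derivative_eq_intros simp: field_simps power2_eq_square)
  then show "\<exists>d. DERIV (\<lambda>z. (exp z - 1) / z) z :> d \<and> 0 \<le> d"
    using exp_minus_one_le[of z] by fastforce
qed

section \<open>Convexity of (exp x - 1)^2 in the variable x^2\<close>

definition expm1_sq :: "real \<Rightarrow> real" where
  "expm1_sq x = (exp x - 1)\<^sup>2"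

text \<open>It exceeds 1 for x > 0 and tends to 1 at 0, so a tangent with slope at most 1 touches at
  no x > 0; this is the source of the case distinctions below.\<close>

definition slope :: "real \<Rightarrow> real" where
  "slope x = exp x * (exp x - 1) / x"

lemma expm1_sq_0 [simp]: "expm1_sq 0 = 0"
  by (simp add: expm1_sq_def)

lemma DERIV_expm1_sq: "DERIV expm1_sq x :> 2 * exp x * (exp x - 1)"
  unfolding expm1_sq_def [abs_def]
  by (auto intro!: derivative_eq_intros simp: algebra_simps)

lemma DERIV_slope:
  "x > 0 \<Longrightarrow> DERIV slope x :> exp x * (x * (2 * exp x - 1) - (exp x - 1)) / x\<^sup>2"
  unfolding slope_def [abs_def]
  by (auto intro!: derivative_eq_intros simp: field_simps power2_eq_square)

lemma slope_ge_exp: "x > 0 \<Longrightarrow> exp x \<le> slope x"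
  using mult_left_mono[of x "exp x - 1" "exp x"] exp_ge_add_one_self[of x]
  by (simp add: slope_def pos_le_divide_eq add_le_imp_le_diff algebra_simps)

lemma slope_pos: "x > 0 \<Longrightarrow> 0 < slope x"
  using slope_ge_exp[of x] exp_gt_zero[of x] by linarith

lemma slope_le_exp:
  assumes "x > 0" shows "slope x \<le> exp (2 * x)"
proof -
  have "exp x * (exp x - 1) \<le> exp x * (x * exp x)"
    by (intro mult_left_mono exp_minus_one_le) auto
  then show ?thesis
    using assms unfolding slope_def exp_double by (simp add: pos_divide_le_eq power2_eq_square mult_ac)
qed

lemma slope_numerator_nonneg:
  fixes x :: real
  assumes "x > 0"
  shows "0 \<le> x * (2 * exp x - 1) - (exp x - 1)"
proof -
  have "0 \<le> x * (exp x - 1)" using assms by simp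
  then show ?thesis using exp_minus_one_le[of x] by (simp add: algebra_simps)
qed

lemma slope_mono:
  assumes "0 < x" "x \<le> y" shows "slope x \<le> slope y"
proof (rule DERIV_nonneg_imp_nondecreasing[OF assms(2)])
  fix z assume "x \<le> z" "z \<le> y"
  then have z: "z > 0" using assms by simp
  show "\<exists>d. DERIV slope z :> d \<and> 0 \<le> d"
    using DERIV_slope[OF z] slope_numerator_nonneg[OF z] by fastforce
qed

text \<open>The bounds \<open>exp x \<le> slope x\<close> and
  \<open>slope x \<le> exp (2 * x)\<close> bracket a solution between \<open>ln \<mu> / 2\<close>
  and \<open>ln \<mu>\<close>.\<close>

lemma slope_surj:
  assumes "\<mu> > 1" obtains x where "x > 0" "slope x = \<mu>"
proof -
  have l: "ln \<mu> > 0" using assms by simp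
  have "\<exists>x. ln \<mu> / 2 \<le> x \<and> x \<le> ln \<mu> \<and> slope x = \<mu>"
  proof (rule IVT')
    show "slope (ln \<mu> / 2) \<le> \<mu>"
      using slope_le_exp[of "ln \<mu> / 2"] l assms by simp
    show "\<mu> \<le> slope (ln \<mu>)" using slope_ge_exp[OF l] assms by simp
    show "continuous_on {ln \<mu> / 2..ln \<mu>} slope"
      using l by (intro continuous_at_imp_continuous_on)
        (auto intro!: DERIV_isCont DERIV_slope)
  qed (use l in auto)
  then obtain x where "ln \<mu> / 2 \<le> x" "slope x = \<mu>" by blast
  then show thesis using l by (intro that[of x]) linarith+
qed

text \<open>In the variable \<open>x\<^sup>2\<close> the function \<open>expm1_sq\<close> is convex with derivative \<open>slope\<close>.\<close>

lemma expm1_sq_tangent: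
  assumes "0 \<le> x" "0 < y"
  shows "expm1_sq y - slope y * y\<^sup>2 \<le> expm1_sq x - slope y * x\<^sup>2"
proof -
  let ?f = "\<lambda>x. expm1_sq x - slope y * x\<^sup>2"
  have D: "DERIV ?f z :> 2 * (exp z * (exp z - 1)) - 2 * slope y * z" for z
    by (auto intro!: derivative_eq_intros DERIV_expm1_sq simp: mult.assoc)
  have E: "exp z * (exp z - 1) = slope z * z" if "z > 0" for z
    using that by (simp add: slope_def)
  show ?thesis
  proof (cases "y \<le> x")
    case True
    show ?thesis
    proof (rule DERIV_nonneg_imp_nondecreasing[OF True])
      fix z assume "y \<le> z" "z \<le> x"
      then have "0 \<le> 2 * (exp z * (exp z - 1)) - 2 * slope y * z"
        using assms slope_mono[of y z] E[of z] by simp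
      with D show "\<exists>d. DERIV ?f z :> d \<and> 0 \<le> d" by blast
    qed
  next
    case False
    show ?thesis
    proof (rule DERIV_nonpos_imp_nonincreasing[of x y ?f])
      show "x \<le> y" using False by simp
      fix z assume z: "x \<le> z" "z \<le> y"
      have "2 * (exp z * (exp z - 1)) - 2 * slope y * z \<le> 0"
      proof (cases "z = 0")
        case False
        then have "z > 0" using z assms by simp
        then show ?thesis using slope_mono[of z y] E[of z] z by simp
      qed simp
      with D show "\<exists>d. DERIV ?f z :> d \<and> d \<le> 0" by blast
    qed
  qed
qed

section \<open>Lower bound for the Lagrangian in one variable\<close>

lemma slope_differential_inequality:
  assumes "x > 0"
  defines "s' \<equiv> exp x * (x * (2 * exp x - 1) - (exp x - 1)) / x\<^sup>2"
  shows "2 * x * (slope x)\<^sup>2 \<le> s' * (expm1_sq x - 1 + slope x)"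
proof -
  define E where "E = exp x"
  have E1: "E > 1" using assms by (simp add: E_def)
  have a: "0 \<le> (E - 1) * (x * (E + 1) - 2 * (E - 1))"
    using exp_pade_bound[of x] assms E1 by (intro mult_nonneg_nonneg) (auto simp: E_def)
  have b: "0 \<le> x * (E\<^sup>2 - 1 - 2 * x * E)"
    using exp_sinh_bound[of x] assms by (intro mult_nonneg_nonneg) (auto simp: E_def)
  have "s' * (expm1_sq x - 1 + slope x) - 2 * x * (slope x)\<^sup>2 =
      E\<^sup>2 / x ^ 3 * (x * (E\<^sup>2 - 1) - (E - 1)\<^sup>2 - x\<^sup>2 * E)"
    using assms unfolding s'_def slope_def expm1_sq_def E_def[symmetric]
    by (simp add: field_simps power2_eq_square power3_eq_cube)
  \<comment> \<open>The remaining factor is the mean of the two quantities shown nonnegative in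
    \<open>a\<close> and \<open>b\<close>, that is, of tanh(x/2) \<le> x/2 and x \<le> sinh
    x.\<close>
  moreover have "x * (E\<^sup>2 - 1) - (E - 1)\<^sup>2 - x\<^sup>2 * E =
      ((E - 1) * (x * (E + 1) - 2 * (E - 1)) + x * (E\<^sup>2 - 1 - 2 * x * E)) / 2"
    by (simp add: field_simps power2_eq_square)
  moreover have "0 \<le> E\<^sup>2 / x ^ 3" using assms by simp
  ultimately show ?thesis using a b
    by (smt (verit) divide_nonneg_pos mult_nonneg_nonneg)
qed

text \<open>\<open>minorant p h + minorant p (- h)\<close> equals
  \<open>2 * expm1_sq p + exp h + exp (- h) - 2 - slope p * (2 * p\<^sup>2 + h\<^sup>2)\<close>, so a lower bound of
  \<open>exp (- h) * expm1_sq r - slope p * r\<^sup>2\<close> by \<open>minorant p h\<close>, added to the same bound for \<open>- h\<close>,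
  gives the two-point inequality.\<close>

definition minorant :: "real \<Rightarrow> real \<Rightarrow> real" where
  "minorant p h = exp (-h) - 1 + h - slope p * (h\<^sup>2 / 2 + p\<^sup>2) + expm1_sq p * (1 - h)"

text \<open>For fixed h the expression on the right is minimal where
  \<open>exp (-h) * slope x = slope p\<close>; here x is the parameter and h the function of x that
  makes x this minimiser. At x = p, where h = 0, both sides agree. The part of
  \<open>minorant\<close> that is odd in h cancels in the two-point inequality and is chosen so that
  both sides also agree to first order.\<close>

lemma minorant_at_tangent_point:
  assumes x: "x > 0" and p: "p > 0"
  defines "h \<equiv> ln (slope x) - ln (slope p)"
  shows "minorant p h \<le> exp (-h) * expm1_sq x - slope p * x\<^sup>2"
proof -
  define H where "H x = ln (slope x) - ln (slope p)" for x
  define s' where "s' x = exp x * (x * (2 * exp x - 1) - (exp x - 1)) / x\<^sup>2" for x :: real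
  \<comment> \<open>\<open>\<tau>\<close> is the right side minus the left side, with
    \<open>slope p / slope x\<close> in place of \<open>exp (-h)\<close>. As x is a critical point,
    the contributions of the derivatives of \<open>expm1_sq x\<close> and x^2 cancel in
    \<open>\<tau>'\<close>, which leaves the factor \<open>\<omega>\<close>.\<close>
  define \<tau> where "\<tau> x = slope p * ((expm1_sq x - 1) / slope x) - slope p * (x\<^sup>2 - p\<^sup>2 - (H x)\<^sup>2 / 2)
    + (1 - expm1_sq p) * (1 - H x)" for x
  define \<omega> where "\<omega> x = slope p * H x - slope p * ((expm1_sq x - 1) / slope x) - (1 - expm1_sq p)" for x
  have s': "DERIV slope x :> s' x" if "x > 0" for x
    using DERIV_slope[OF that] by (simp add: s'_def)
  have s'0: "s' x \<ge> 0" if "x > 0" for x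
    using slope_numerator_nonneg[OF that] by (simp add: s'_def)
  have K': "DERIV expm1_sq x :> 2 * x * slope x" if "x > 0" for x
    using DERIV_expm1_sq[of x] that by (simp add: slope_def mult.assoc)
  have H': "DERIV H x :> s' x / slope x" if "x > 0" for x
    unfolding H_def using slope_pos[OF that]
    by (auto intro!: derivative_eq_intros s' that simp: field_simps)
  have \<tau>': "DERIV \<tau> x :> s' x / slope x * \<omega> x" if "x > 0" for x
    unfolding \<tau>_def \<omega>_def using slope_pos[OF that]
    by (auto intro!: derivative_eq_intros s' K' H' that simp: field_simps power2_eq_square)
  have \<omega>': "DERIV \<omega> x :> slope p / (slope x)\<^sup>2 * (s' x * (expm1_sq x - 1 + slope x) - 2 * x * (slope x)\<^sup>2)"
    if "x > 0" for x
    unfolding \<omega>_def using slope_pos[OF that]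
    by (auto intro!: derivative_eq_intros s' K' H' that simp: field_simps power2_eq_square)
  \<comment> \<open>The sign of the derivative is \<open>slope_differential_inequality\<close>.
    Together with \<open>\<omega> p = 0\<close>, monotonicity makes p the minimum of
    \<open>\<tau>\<close>.\<close>
  have \<omega>_mono: "\<omega> x \<le> \<omega> y" if "0 < x" "x \<le> y" for x y
  proof (rule DERIV_nonneg_imp_nondecreasing[OF that(2)])
    fix z assume "x \<le> z" "z \<le> y"
    then have z: "z > 0" using that by simp
    have "0 \<le> slope p / (slope z)\<^sup>2 * (s' z * (expm1_sq z - 1 + slope z) - 2 * z * (slope z)\<^sup>2)"
      using slope_differential_inequality[OF z] slope_pos[OF p]
      by (intro mult_nonneg_nonneg) (auto simp: s'_def)
    with \<omega>'[OF z] show "\<exists>d. DERIV \<omega> z :> d \<and> 0 \<le> d" by blast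
  qed
  have \<omega>p: "\<omega> p = 0" and \<tau>p: "\<tau> p = 0"
    using slope_pos[OF p] by (simp_all add: \<omega>_def \<tau>_def H_def)
  have "0 \<le> \<tau> x"
  proof (cases "p \<le> x")
    case True
    have "\<tau> p \<le> \<tau> x"
    proof (rule DERIV_nonneg_imp_nondecreasing[OF True])
      fix z assume z: "p \<le> z" "z \<le> x"
      then have z0: "z > 0" using p by simp
      have "0 \<le> s' z / slope z * \<omega> z"
        using s'0[OF z0] slope_pos[OF z0] \<omega>_mono[OF p z(1)] \<omega>p by simp
      with \<tau>'[OF z0] show "\<exists>d. DERIV \<tau> z :> d \<and> 0 \<le> d" by blast
    qed
    then show ?thesis using \<tau>p by simp
  next
    case False
    have "\<tau> p \<le> \<tau> x"
    proof (rule DERIV_nonpos_imp_nonincreasing[of x p])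
      show "x \<le> p" using False by simp
      fix z assume z: "x \<le> z" "z \<le> p"
      then have z0: "z > 0" using x by simp
      have "s' z / slope z * \<omega> z \<le> 0"
        using s'0[OF z0] slope_pos[OF z0] \<omega>_mono[OF z0 z(2)] \<omega>p
        by (intro mult_nonneg_nonpos) auto
      with \<tau>'[OF z0] show "\<exists>d. DERIV \<tau> z :> d \<and> d \<le> 0" by blast
    qed
    then show ?thesis using \<tau>p by simp
  qed
  moreover have "exp (-h) = slope p / slope x"
    using slope_pos[OF x] slope_pos[OF p] by (simp add: h_def exp_diff)
  ultimately show ?thesis
    unfolding minorant_def \<tau>_def H_def h_def[symmetric]
    by (simp add: algebra_simps add_divide_distrib diff_divide_distrib)
qed

text \<open>The hypothesis on h says that the required slope \<open>exp h * slope p\<close> exceeds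
  1, the limit of \<open>slope\<close> at 0. So a tangent point x exists, and convexity carries the
  bound from x to every r.\<close>

lemma minorant_le:
  assumes p: "p > 0" and r: "0 \<le> r" and h: "1 < exp h * slope p"
  shows "minorant p h \<le> exp (-h) * expm1_sq r - slope p * r\<^sup>2"
proof -
  obtain x where x: "x > 0" "slope x = exp h * slope p" using slope_surj[OF h] .
  have hx: "h = ln (slope x) - ln (slope p)"
    using x(2) slope_pos[OF p] by (simp add: ln_mult)
  have e: "exp (-h) * slope x = slope p" by (simp add: x(2) exp_minus)
  have "minorant p h \<le> exp (-h) * expm1_sq x - slope p * x\<^sup>2"
    using minorant_at_tangent_point[OF x(1) p] hx by simp
  also have "\<dots> = exp (-h) * (expm1_sq x - slope x * x\<^sup>2)"
    by (simp add: e[symmetric] algebra_simps)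
  also have "\<dots> \<le> exp (-h) * (expm1_sq r - slope x * r\<^sup>2)"
    by (intro mult_left_mono expm1_sq_tangent r x) auto
  also have "\<dots> = exp (-h) * expm1_sq r - slope p * r\<^sup>2"
    by (simp add: e[symmetric] algebra_simps)
  finally show ?thesis .
qed

text \<open>If \<open>slope p \<le> exp h\<close>, there is no tangent point for -h, and the best
  lower bound of \<open>exp h * expm1_sq q - slope p * q\<^sup>2\<close> is its value 0 at q = 0.
  Beyond \<open>ln (slope p)\<close> the function \<open>minorant p (-h)\<close> is convex in h, so
  the ends of the range suffice; at h = 2 p the claim is \<open>exp_pade_bound\<close>.\<close>

lemma minorant_nonpos:
  assumes p: "p > 0" and h: "slope p \<le> exp h" "h \<le> 2 * p"
  shows "minorant p (-h) \<le> 0"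
proof -
  define h0 where "h0 = ln (slope p)"
  define f where "f h = minorant p (-h)" for h
  have f_eq: "f = (\<lambda>h. exp h - 1 - h - slope p * (h\<^sup>2 / 2 + p\<^sup>2) + expm1_sq p * (1 + h))"
    by (auto simp: f_def minorant_def)
  have h0: "h0 \<le> h"
    using h(1) slope_pos[OF p] unfolding h0_def
    by (metis exp_gt_zero ln_exp ln_le_cancel_iff)
  have "f h0 \<le> 0"
  \<comment> \<open>At \<open>h0\<close> the tangent point has degenerated to 0, so
    \<open>minorant_le\<close> with r = 0 is available only for k < \<open>h0\<close>; continuity
    gives the end value.\<close>
  proof (rule tendsto_upperbound)
    have "isCont f h0" unfolding f_eq by (auto intro!: continuous_intros)
    then show "(f \<longlongrightarrow> f h0) (at_left h0)"
      by (simp add: isCont_def filterlim_at_split)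
    have "f k \<le> 0" if "k < h0" for k
    proof -
      have "exp k < slope p"
        using that slope_pos[OF p] by (metis exp_less_mono exp_ln h0_def)
      then have "1 < exp (-k) * slope p" by (simp add: exp_minus field_simps)
      from minorant_le[OF p order_refl this] show ?thesis by (simp add: f_def)
    qed
    then show "\<forall>\<^sub>F k in at_left h0. f k \<le> 0"
      by (auto simp: eventually_at_left_field intro!: exI[of _ "h0 - 1"])
  qed simp
  moreover have "f (2 * p) \<le> 0"
  proof -
    have "exp p * (2 * (exp p - 1)) \<le> exp p * (p * (exp p + 1))"
      using exp_pade_bound[of p] p by (intro mult_left_mono) auto
    moreover have "f (2 * p) = exp p * (2 * (exp p - 1)) - exp p * (p * (exp p + 1))"
      using p unfolding f_eq exp_double
      by (simp add: slope_def expm1_sq_def field_simps power2_eq_square)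
    ultimately show ?thesis by simp
  qed
  moreover have "convex_on {h0..2 * p} f"
  proof (rule f''_ge0_imp_convex)
    show "DERIV f x :> exp x - 1 - slope p * x + expm1_sq p" for x
      unfolding f_eq by (auto intro!: derivative_eq_intros)
    show "DERIV (\<lambda>x. exp x - 1 - slope p * x + expm1_sq p) x :> exp x - slope p" for x
      by (auto intro!: derivative_eq_intros)
    show "0 \<le> exp x - slope p" if "x \<in> {h0..2 * p}" for x
      using that slope_pos[OF p] by (simp add: h0_def ln_ge_iff) (metis exp_le_cancel_iff exp_ln)
  qed auto
  ultimately have "f h \<le> max (f h0) (f (2 * p))"
    using h0 h(2) by (intro convex_on_le_max) auto
  then show ?thesis using \<open>f h0 \<le> 0\<close> \<open>f (2 * p) \<le> 0\<close> by (simp add: f_def)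
qed

lemma expm1_sq_ge: "0 \<le> x \<Longrightarrow> x\<^sup>2 \<le> expm1_sq x"
  unfolding expm1_sq_def using exp_ge_add_one_self[of x] by (intro power_mono) linarith+

text \<open>For h < 2 p the multiplier is \<open>slope p\<close>, which is stationary at h = 0, q =
  r = p. For h \<ge> 2 p it is \<open>exp (-h) * slope h\<close>, for which the extremal split p = q
  = 0, r = h is optimal.\<close>

lemma dyadic_inequality_nonneg:
  assumes pos: "0 \<le> p" "0 \<le> q" "0 \<le> r" "0 \<le> h" and eq: "q\<^sup>2 + r\<^sup>2 = 2 * p\<^sup>2 + h\<^sup>2"
  shows "2 * expm1_sq p + exp h + exp (-h) - 2 \<le> exp h * expm1_sq q + exp (-h) * expm1_sq r"
proof (cases "h < 2 * p")
  case True
  then have p: "p > 0" using pos by simp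
  have p1: "1 < slope p" using slope_ge_exp[OF p] p by (smt (verit) exp_ge_add_one_self)
  have "1 * 1 < exp h * slope p" using p1 pos by (intro mult_le_less_imp_less) auto
  then have r: "minorant p h \<le> exp (-h) * expm1_sq r - slope p * r\<^sup>2"
    using minorant_le[OF p pos(3)] by simp
  have q: "minorant p (-h) \<le> exp h * expm1_sq q - slope p * q\<^sup>2"
  proof (cases "slope p \<le> exp h")
    case True
    have "slope p * q\<^sup>2 \<le> exp h * expm1_sq q"
      using True pos expm1_sq_ge slope_pos[OF p] by (intro mult_mono) auto
    then show ?thesis using minorant_nonpos[OF p True] \<open>h < 2 * p\<close> by simp
  next
    case False
    then have "1 < exp (-h) * slope p" by (simp add: exp_minus field_simps)
    then show ?thesis using minorant_le[OF p pos(2), of "-h"] by simp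
  qed
  have "slope p * (q\<^sup>2 + r\<^sup>2) = slope p * (2 * p\<^sup>2 + h\<^sup>2)" using eq by simp
  with q r show ?thesis by (simp add: minorant_def algebra_simps)
next
  case hp: False
  show ?thesis
  proof (cases "h = 0")
    case True
    then have "p = 0" "q = 0" "r = 0" using hp pos eq by auto
    then show ?thesis using True by simp
  next
    case h0: False
    then have h: "h > 0" using pos by simp
    have "exp (-h) * slope h * q\<^sup>2 \<le> exp h * expm1_sq q"
    proof (intro mult_mono expm1_sq_ge pos)
      show "exp (-h) * slope h \<le> exp h"
        using slope_le_exp[OF h] unfolding exp_double
          by (simp add: exp_minus power2_eq_square field_simps)
    qed auto
    moreover have "exp (-h) * (expm1_sq h - slope h * h\<^sup>2) \<le> exp (-h) * (expm1_sq r - slope h * r\<^sup>2)"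
      by (intro mult_left_mono expm1_sq_tangent pos h) auto
    moreover have "exp (-h) * expm1_sq h = exp h + exp (-h) - 2"
      by (simp add: expm1_sq_def power2_eq_square exp_minus field_simps)
    \<comment> \<open>Here h \<ge> 2 p enters: for p > 0, \<open>expm1_sq p\<close> / p^2 is at most
      (exp (2 p) - 1) / (2 p), hence at most (exp h - 1) / h, which is the multiplier.\<close>
    moreover have "2 * expm1_sq p \<le> exp (-h) * slope h * (2 * p\<^sup>2)"
    proof (cases "p = 0")
      case False
      then have p: "p > 0" using pos by simp
      have "p * (exp p - 1)\<^sup>2 * 2 \<le> p * (exp p - 1) * (p * (exp p + 1))"
        using exp_pade_bound[of p] p
        by (simp add: power2_eq_square mult.assoc mult_left_mono)
      then have "2 * p * expm1_sq p \<le> p\<^sup>2 * (exp (2 * p) - 1)"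
        unfolding exp_double by (simp add: expm1_sq_def power2_eq_square algebra_simps)
      then have "expm1_sq p \<le> (exp (2 * p) - 1) / (2 * p) * p\<^sup>2"
        using p by (simp add: field_simps)
      also have "\<dots> \<le> (exp h - 1) / h * p\<^sup>2"
        using expm1_over_mono[of "2 * p" h] p hp by (intro mult_right_mono) auto
      also have "\<dots> = exp (-h) * slope h * p\<^sup>2"
        using mult_exp_exp[of "-h" h] by (simp add: slope_def flip: mult.assoc)
      finally show ?thesis by simp
    qed simp
    moreover have "exp (-h) * slope h * (q\<^sup>2 + r\<^sup>2) = exp (-h) * slope h * (2 * p\<^sup>2 + h\<^sup>2)"
      using eq by simp
    ultimately show ?thesis by (simp add: algebra_simps)
  qed
qed

lemma dyadic_inequality:
  assumes "0 \<le> p" "0 \<le> q" "0 \<le> r" "q\<^sup>2 + r\<^sup>2 = 2 * p\<^sup>2 + h\<^sup>2"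
  shows "exp h * (1 - expm1_sq q) + exp (-h) * (1 - expm1_sq r) \<le> 2 * (1 - expm1_sq p)"
proof (cases "0 \<le> h")
  case True
  then show ?thesis
    using dyadic_inequality_nonneg[of p q r h] assms by (simp add: algebra_simps)
next
  case False
  then show ?thesis
    using dyadic_inequality_nonneg[of p r q "-h"] assms by (simp add: algebra_simps)
qed

section \<open>The upper bound along dyadic means\<close>

definition mean :: "(real \<Rightarrow> real) \<Rightarrow> real \<Rightarrow> real \<Rightarrow> real" where
  "mean f a b = (LINT x:{a..<b}|lebesgue. f x) / (b - a)"

text \<open>On \<open>{a..<b}\<close> this is the conditional expectation of f on the n-th dyadic
  generation. Recursion from the root lets inductions over n generalise over the interval, without
  enumerating the 2^n cells.\<close>

fun dyadic_mean :: "nat \<Rightarrow> (real \<Rightarrow> real) \<Rightarrow> real \<Rightarrow> real \<Rightarrow> real \<Rightarrow> real" where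
  "dyadic_mean 0 f a b x = mean f a b"
| "dyadic_mean (Suc n) f a b x =
    (if x < (a + b) / 2 then dyadic_mean n f a ((a + b) / 2) x
     else dyadic_mean n f ((a + b) / 2) b x)"

lemma set_integrable_lebesgue_Ico:
  "integrable lebesgue f \<Longrightarrow> set_integrable lebesgue {a..<b::real} f"
  for f :: "real \<Rightarrow> real"
  unfolding set_integrable_def by (rule integrable_mult_indicator) auto

lemma emeasure_lebesgue_Ico: "a \<le> b \<Longrightarrow> emeasure lebesgue {a..<b::real} = ennreal (b - a)"
  by (simp add: emeasure_completion)

lemma measure_lebesgue_Ico: "a \<le> b \<Longrightarrow> measure lebesgue {a..<b::real} = b - a"
  by (simp add: measure_def emeasure_lebesgue_Ico)

lemma set_integral_Ico_const:
  "a \<le> b \<Longrightarrow> (LINT x:{a..<b}|lebesgue. (k::real)) = (b - a) * k"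
  by (simp add: set_lebesgue_integral_def measure_lebesgue_Ico)

lemma Ico_split:
  fixes a b :: real
  assumes "a < b"
  shows "{a..<b} = {a..<(a + b) / 2} \<union> {(a + b) / 2..<b}"
    "{a..<(a + b) / 2} \<inter> {(a + b) / 2..<b} = {}"
  using assms by (auto simp: field_simps)

lemma mean_split:
  assumes "a < b" "integrable lebesgue f"
  shows "mean f a b = (mean f a ((a + b) / 2) + mean f ((a + b) / 2) b) / 2"
proof -
  have "(LINT x:{a..<b}|lebesgue. f x) =
      (LINT x:{a..<(a + b) / 2}|lebesgue. f x) + (LINT x:{(a + b) / 2..<b}|lebesgue. f x)"
    using assms by (subst Ico_split(1)) (auto intro!: set_integral_Un set_integrable_lebesgue_Ico Ico_split)
  moreover have "(a + b) / 2 - a = (b - a) / 2" "b - (a + b) / 2 = (b - a) / 2"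
    by (simp_all add: field_simps)
  ultimately show ?thesis unfolding mean_def by (simp add: add_divide_distrib)
qed

lemma mean_diff:
  assumes "integrable lebesgue f" "integrable lebesgue g"
  shows "mean (\<lambda>x. f x - g x) a b = mean f a b - mean g a b"
  using assms by (simp add: mean_def set_integral_diff set_integrable_lebesgue_Ico diff_divide_distrib)

lemma set_integrable_Ico_const: "set_integrable lebesgue {a..<b::real} (\<lambda>x. k :: real)"
  using emeasure_lborel_Ico[of a b]
  by (cases "a \<le> b") (auto simp: set_integrable_def emeasure_lebesgue_Ico)

lemma mean_le_const:
  assumes "a < b" "integrable lebesgue f" "\<And>x. x \<in> {a..<b} \<Longrightarrow> f x \<le> k"
  shows "mean f a b \<le> k"
proof -
  have "(LINT x:{a..<b}|lebesgue. f x) \<le> (LINT x:{a..<b}|lebesgue. k)"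
    using assms by (intro set_integral_mono set_integrable_lebesgue_Ico set_integrable_Ico_const) auto
  then show ?thesis
    using assms by (simp add: mean_def set_integral_Ico_const field_simps)
qed

lemma mean_ge_const:
  assumes "a < b" "integrable lebesgue f" "\<And>x. x \<in> {a..<b} \<Longrightarrow> k \<le> f x"
  shows "k \<le> mean f a b"
proof -
  have "(LINT x:{a..<b}|lebesgue. k) \<le> (LINT x:{a..<b}|lebesgue. f x)"
    using assms by (intro set_integral_mono set_integrable_lebesgue_Ico set_integrable_Ico_const) auto
  then show ?thesis
    using assms by (simp add: mean_def set_integral_Ico_const field_simps)
qed

text \<open>Integrate 0 \<le> (f - m)^2 for the mean m. The constant m^2 is moved to the other side
  because constants are not integrable on the whole line, as \<open>mean_diff\<close> would
  demand.\<close>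

lemma mean_square_ge:
  assumes "a < b" "integrable lebesgue f" "integrable lebesgue (\<lambda>x. (f x)\<^sup>2)"
  shows "(mean f a b)\<^sup>2 \<le> mean (\<lambda>x. (f x)\<^sup>2) a b"
proof -
  let ?m = "mean f a b"
  have "- ?m\<^sup>2 \<le> (f x)\<^sup>2 - 2 * ?m * f x" for x
    using zero_le_power2[of "f x - ?m"] by (simp add: power2_diff algebra_simps)
  then have "- ?m\<^sup>2 \<le> mean (\<lambda>x. (f x)\<^sup>2 - 2 * ?m * f x) a b"
    using assms by (intro mean_ge_const) auto
  also have "\<dots> = mean (\<lambda>x. (f x)\<^sup>2) a b - mean (\<lambda>x. 2 * ?m * f x) a b"
    using assms by (intro mean_diff) auto
  also have "mean (\<lambda>x. 2 * ?m * f x) a b = 2 * ?m * ?m"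
    by (simp add: mean_def)
  finally show ?thesis by (simp add: power2_eq_square)
qed

section \<open>Convergence of dyadic means in L^1\<close>

lemma borel_measurable_dyadic_mean [measurable]:
  "dyadic_mean n f a b \<in> borel_measurable borel"
proof (induction n arbitrary: a b)
  case 0
  have "dyadic_mean 0 f a b = (\<lambda>x. mean f a b)" by auto
  then show ?case by simp
next
  case (Suc n)
  note Suc.IH [measurable]
  have "dyadic_mean (Suc n) f a b = (\<lambda>x. if x < (a + b) / 2 then dyadic_mean n f a ((a + b) / 2) x
      else dyadic_mean n f ((a + b) / 2) b x)" by auto
  also have "\<dots> \<in> borel_measurable borel" by measurable
  finally show ?case .
qed

lemma borel_measurable_dyadic_mean_lebesgue [measurable]:
  "dyadic_mean n f a b \<in> borel_measurable lebesgue"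
  by (simp add: measurable_completion)

lemma nn_integral_Ico_split:
  fixes a b :: real
  assumes "a < b" "f \<in> borel_measurable lebesgue"
  shows "(\<integral>\<^sup>+x\<in>{a..<b}. f x \<partial>lebesgue) =
    (\<integral>\<^sup>+x\<in>{a..<(a + b) / 2}. f x \<partial>lebesgue) + (\<integral>\<^sup>+x\<in>{(a + b) / 2..<b}. f x \<partial>lebesgue)"
  using assms Ico_split[OF assms(1)] by (subst Ico_split(1)) (auto intro!: nn_integral_disjoint_pair)

text \<open>Conditional expectations contract L^1; this allows f to be replaced by a continuous
  function in the convergence proof.\<close>

lemma nn_integral_dist_dyadic_mean:
  assumes "a < b" and f: "integrable lebesgue f" and g: "integrable lebesgue g"
  shows "(\<integral>\<^sup>+x\<in>{a..<b}. ennreal \<bar>dyadic_mean n f a b x - dyadic_mean n g a b x\<bar> \<partial>lebesgue)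
    \<le> (\<integral>\<^sup>+x\<in>{a..<b}. ennreal \<bar>f x - g x\<bar> \<partial>lebesgue)"
  using assms(1)
proof (induction n arbitrary: a b)
  case 0
  let ?A = "{a..<b}"
  have i: "set_integrable lebesgue ?A (\<lambda>x. f x - g x)"
    using f g by (intro set_integrable_lebesgue_Ico) auto
  have "(\<integral>\<^sup>+x\<in>?A. ennreal \<bar>dyadic_mean 0 f a b x - dyadic_mean 0 g a b x\<bar> \<partial>lebesgue) =
      ennreal (\<bar>mean f a b - mean g a b\<bar> * (b - a))"
    using 0 by (simp add: nn_integral_cmult_indicator emeasure_lebesgue_Ico ennreal_mult)
  also have "\<bar>mean f a b - mean g a b\<bar> * (b - a) = \<bar>LINT x:?A|lebesgue. f x - g x\<bar>"
    using 0 by (simp add: mean_diff[OF f g, symmetric]) (simp add: mean_def)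
  also have "\<dots> \<le> (LINT x:?A|lebesgue. \<bar>f x - g x\<bar>)"
    using set_integral_norm_bound[OF i] by simp
  also have "ennreal (LINT x:?A|lebesgue. \<bar>f x - g x\<bar>) = (\<integral>\<^sup>+x\<in>?A. ennreal \<bar>f x - g x\<bar> \<partial>lebesgue)"
    using set_integrable_abs[OF i] unfolding set_lebesgue_integral_def set_integrable_def
    by (subst nn_integral_eq_integral[symmetric])
      (auto intro!: nn_integral_cong simp: indicator_def)
  finally show ?case by (simp add: ennreal_leI)
next
  case (Suc n)
  let ?m = "(a + b) / 2"
  have m: "a < ?m" "?m < b" using Suc.prems by auto
  have [measurable]: "f \<in> borel_measurable lebesgue" "g \<in> borel_measurable lebesgue"
    using f g by auto
  have [measurable]: "dyadic_mean (Suc n) f a b \<in> borel_measurable lebesgue" for f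
    by (rule borel_measurable_dyadic_mean_lebesgue)
  have "(\<integral>\<^sup>+x\<in>{a..<b}. ennreal \<bar>dyadic_mean (Suc n) f a b x - dyadic_mean (Suc n) g a b x\<bar> \<partial>lebesgue) =
      (\<integral>\<^sup>+x\<in>{a..<?m}. ennreal \<bar>dyadic_mean (Suc n) f a b x - dyadic_mean (Suc n) g a b x\<bar> \<partial>lebesgue) +
      (\<integral>\<^sup>+x\<in>{?m..<b}. ennreal \<bar>dyadic_mean (Suc n) f a b x - dyadic_mean (Suc n) g a b x\<bar> \<partial>lebesgue)"
    by (intro nn_integral_Ico_split Suc.prems) measurable
  also have "\<dots> = (\<integral>\<^sup>+x\<in>{a..<?m}. ennreal \<bar>dyadic_mean n f a ?m x - dyadic_mean n g a ?m x\<bar> \<partial>lebesgue) +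
      (\<integral>\<^sup>+x\<in>{?m..<b}. ennreal \<bar>dyadic_mean n f ?m b x - dyadic_mean n g ?m b x\<bar> \<partial>lebesgue)"
    by (intro arg_cong2[where f = "(+)"] nn_integral_cong) (auto simp: indicator_def)
  also have "\<dots> \<le> (\<integral>\<^sup>+x\<in>{a..<?m}. ennreal \<bar>f x - g x\<bar> \<partial>lebesgue) +
      (\<integral>\<^sup>+x\<in>{?m..<b}. ennreal \<bar>f x - g x\<bar> \<partial>lebesgue)"
    using Suc.IH m by (intro add_mono)
  also have "\<dots> = (\<integral>\<^sup>+x\<in>{a..<b}. ennreal \<bar>f x - g x\<bar> \<partial>lebesgue)"
    by (intro nn_integral_Ico_split[symmetric] Suc.prems) measurable
  finally show ?case .
qed

lemma dyadic_mean_uniform: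
  assumes "a < b" and g: "integrable lebesgue g" and "x \<in> {a..<b}"
    and "\<And>x y. x \<in> {a..<b} \<Longrightarrow> y \<in> {a..<b} \<Longrightarrow> \<bar>x - y\<bar> \<le> (b - a) / 2 ^ n \<Longrightarrow> \<bar>g x - g y\<bar> \<le> \<eta>"
  shows "\<bar>dyadic_mean n g a b x - g x\<bar> \<le> \<eta>"
  using assms(1,3,4)
proof (induction n arbitrary: a b)
  case 0
  have *: "\<bar>g x - g y\<bar> \<le> \<eta>" if "y \<in> {a..<b}" for y
    using that 0(2) by (intro 0(3)) (auto simp: abs_le_iff)
  have "mean g a b \<le> g x + \<eta>"
    using 0(1) g * by (intro mean_le_const) (auto simp: abs_le_iff algebra_simps)
  moreover have "g x - \<eta> \<le> mean g a b"
    using 0(1) g * by (intro mean_ge_const) (auto simp: abs_le_iff algebra_simps)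
  ultimately show ?case by simp
next
  case (Suc n)
  let ?m = "(a + b) / 2"
  have m: "a < ?m" "?m < b" using Suc.prems by auto
  have d: "(?m - a) / 2 ^ n = (b - a) / 2 ^ Suc n" "(b - ?m) / 2 ^ n = (b - a) / 2 ^ Suc n"
    by (simp_all add: field_simps)
  show ?case
  proof (cases "x < ?m")
    case True
    have "\<bar>dyadic_mean n g a ?m x - g x\<bar> \<le> \<eta>"
      using Suc.prems(2) m True by (intro Suc.IH Suc.prems(3)) (auto simp: d)
    with True show ?thesis by simp
  next
    case False
    have "\<bar>dyadic_mean n g ?m b x - g x\<bar> \<le> \<eta>"
      using Suc.prems(2) m False by (intro Suc.IH Suc.prems(3)) (auto simp: d)
    with False show ?thesis by simp
  qed
qed

text \<open>Clamping serves twice: f is cut at a height N, and then the continuous functions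
  converging to f almost everywhere are cut at the same height, which supplies the dominating
  function. The factor \<open>indicator {a..b}\<close> makes the approximants integrable, at the
  price of continuity outside \<open>{a..b}\<close>.\<close>

lemma integrable_approx_continuous:
  fixes f :: "real \<Rightarrow> real"
  assumes f: "integrable lebesgue f" and "a < b" "0 < e"
  obtains g where "continuous_on {a..b} g" "integrable lebesgue g"
    "(\<integral>\<^sup>+x\<in>{a..<b}. ennreal \<bar>f x - g x\<bar> \<partial>lebesgue) < ennreal e"
proof -
  have fm [measurable]: "f \<in> borel_measurable lebesgue" using f by auto
  define clamp where "clamp n y = max (- real n) (min (real n) y)" for n and y :: real
  have cl [measurable]: "clamp n \<in> borel_measurable borel" for n
    unfolding clamp_def by measurable
  have clc: "continuous_on UNIV (clamp n)" for n
    unfolding clamp_def by (intro continuous_intros)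
  have clb: "\<bar>clamp n y\<bar> \<le> real n" "\<bar>clamp n y\<bar> \<le> \<bar>y\<bar>" for n y
    by (auto simp: clamp_def)
  have "(\<lambda>n. \<integral>\<^sup>+x. norm (f x - clamp n (f x)) \<partial>lebesgue) \<longlonglongrightarrow> 0"
  proof (rule nn_integral_dominated_convergence_norm)
    show "AE x in lebesgue. norm (clamp n (f x)) \<le> \<bar>f x\<bar>" for n using clb by simp
    show "(\<integral>\<^sup>+x. ennreal \<bar>f x\<bar> \<partial>lebesgue) < \<infinity>"
      using f by (simp add: integrable_iff_bounded)
    have "\<forall>\<^sub>F n in sequentially. clamp n (f x) = f x" for x
    proof -
      obtain N where "\<bar>f x\<bar> \<le> real N" using real_arch_simple by blast
      then show ?thesis
        by (intro eventually_sequentiallyI[of N]) (auto simp: clamp_def)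
    qed
    then show "AE x in lebesgue. (\<lambda>n. clamp n (f x)) \<longlonglongrightarrow> f x"
      by (simp add: tendsto_eventually)
  qed measurable
  then have "\<forall>\<^sub>F n in sequentially. (\<integral>\<^sup>+x. norm (f x - clamp n (f x)) \<partial>lebesgue) < ennreal (e / 2)"
    using \<open>0 < e\<close> by (intro order_tendstoD) auto
  then obtain N where N: "(\<integral>\<^sup>+x. norm (f x - clamp N (f x)) \<partial>lebesgue) < ennreal (e / 2)"
    by (auto simp: eventually_sequentially)
  have "f measurable_on UNIV"
    by (intro lebesgue_measurable_imp_measurable_on) auto
  then obtain Z g where Z: "negligible Z" and g: "\<And>n. continuous_on UNIV (g n)"
    and lim: "\<And>x. x \<notin> Z \<Longrightarrow> (\<lambda>n. g n x) \<longlonglongrightarrow> f x"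
    unfolding measurable_on_def by auto
  define G where "G n x = indicator {a..b} x * clamp N (g n x)" for n x
  have gm [measurable]: "g n \<in> borel_measurable lebesgue" for n
    using borel_measurable_continuous_onI[OF g] by (simp add: measurable_completion)
  have [measurable]: "{a..b} \<in> sets lebesgue" by simp
  have Gm [measurable]: "G n \<in> borel_measurable lebesgue" for n
    unfolding G_def by measurable
  have "(\<lambda>n. \<integral>\<^sup>+x. norm (indicator {a..b} x * clamp N (f x) - G n x) \<partial>lebesgue) \<longlonglongrightarrow> 0"
  proof (rule nn_integral_dominated_convergence_norm)
    show "AE x in lebesgue. norm (G n x) \<le> real N * indicator {a..b} x" for n
      using clb by (auto simp: G_def indicator_def)
    show "(\<integral>\<^sup>+x. ennreal (real N * indicator {a..b} x) \<partial>lebesgue) < \<infinity>"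
      by (simp add: ennreal_mult nn_integral_cmult_indicator ennreal_indicator ennreal_mult_less_top
          emeasure_completion emeasure_lborel_Icc_eq)
    have "AE x in lebesgue. x \<notin> Z"
      using Z by (simp add: negligible_iff_null_sets AE_not_in)
    then show "AE x in lebesgue. (\<lambda>n. G n x) \<longlonglongrightarrow> indicator {a..b} x * clamp N (f x)"
    proof eventually_elim
      case (elim x)
      have "isCont (clamp N) (f x)" using clc by (simp add: continuous_on_eq_continuous_at)
      then show ?case unfolding G_def
        by (intro tendsto_intros isCont_tendsto_compose[OF _ lim[OF elim]])
    qed
  qed measurable
  then have "\<forall>\<^sub>F n in sequentially.
      (\<integral>\<^sup>+x. norm (indicator {a..b} x * clamp N (f x) - G n x) \<partial>lebesgue) < ennreal (e / 2)"
    using \<open>0 < e\<close> by (intro order_tendstoD) auto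
  then obtain n where
    n: "(\<integral>\<^sup>+x. norm (indicator {a..b} x * clamp N (f x) - G n x) \<partial>lebesgue) < ennreal (e / 2)"
    by (auto simp: eventually_sequentially)
  show thesis
  proof (rule that[of "G n"])
    have "continuous_on {a..b} (\<lambda>x. clamp N (g n x))"
      using clc g by (intro continuous_on_compose2[OF clc]) (auto intro: continuous_on_subset)
    then show "continuous_on {a..b} (G n)"
      by (rule continuous_on_eq) (auto simp: G_def)
    show "integrable lebesgue (G n)"
    proof (rule Bochner_Integration.integrable_bound)
      show "integrable lebesgue (\<lambda>x. real N * indicator {a..b} x :: real)"
        by (intro integrable_mult_right integrable_real_indicator)
          (auto simp: emeasure_completion emeasure_lborel_Icc_eq)
      show "AE x in lebesgue. norm (G n x) \<le> norm (real N * indicator {a..b} x)"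
        using clb by (auto simp: G_def indicator_def)
    qed (rule Gm)
    have "(\<integral>\<^sup>+x\<in>{a..<b}. ennreal \<bar>f x - G n x\<bar> \<partial>lebesgue)
        \<le> (\<integral>\<^sup>+x. ennreal (norm (f x - clamp N (f x))) +
              ennreal (norm (indicator {a..b} x * clamp N (f x) - G n x)) \<partial>lebesgue)"
      by (intro nn_integral_mono)
        (auto simp: indicator_def G_def simp flip: ennreal_plus intro!: ennreal_leI)
    also have "\<dots> = (\<integral>\<^sup>+x. norm (f x - clamp N (f x)) \<partial>lebesgue) +
        (\<integral>\<^sup>+x. norm (indicator {a..b} x * clamp N (f x) - G n x) \<partial>lebesgue)"
      by (intro nn_integral_add) measurable
    also have "\<dots> < ennreal (e / 2) + ennreal (e / 2)"
      using N n by (rule add_strict_mono)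
    also have "\<dots> = ennreal e" using \<open>0 < e\<close> by (simp flip: ennreal_plus)
    finally show "(\<integral>\<^sup>+x\<in>{a..<b}. ennreal \<bar>f x - G n x\<bar> \<partial>lebesgue) < ennreal e" .
  qed
qed

text \<open>Three-term estimate through a continuous g: the contraction bounds two terms by the
  distance of f and g, uniform continuity bounds the third. \<open>\<eta>\<close> is e/3 spread over
  the length b - a.\<close>

lemma dyadic_mean_tendsto_L1:
  assumes f: "integrable lebesgue f" and "a < b"
  shows "(\<lambda>n. \<integral>\<^sup>+x\<in>{a..<b}. ennreal \<bar>dyadic_mean n f a b x - f x\<bar> \<partial>lebesgue) \<longlonglongrightarrow> 0"
proof (rule order_tendstoI)
  fix y :: ennreal assume "0 < y"
  have [measurable]: "f \<in> borel_measurable lebesgue" using f by auto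
  obtain e where e: "0 < e" "ennreal e \<le> y"
  proof (cases y)
    case (real r)
    then show thesis using \<open>0 < y\<close> by (intro that[of r]) auto
  next
    case top
    then show thesis by (intro that[of 1]) auto
  qed
  obtain g where g: "continuous_on {a..b} g" "integrable lebesgue g"
    and fg: "(\<integral>\<^sup>+x\<in>{a..<b}. ennreal \<bar>f x - g x\<bar> \<partial>lebesgue) < ennreal (e / 3)"
    using integrable_approx_continuous[OF f \<open>a < b\<close>, of "e / 3"] e by auto
  have [measurable]: "g \<in> borel_measurable lebesgue" "{a..<b} \<in> sets lebesgue" using g by auto
  define \<eta> where "\<eta> = e / 3 / (b - a)"
  have \<eta>: "\<eta> > 0" using e \<open>a < b\<close> by (simp add: \<eta>_def)
  have "b - a \<noteq> 0" using \<open>a < b\<close> by simp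
  then have \<eta>_mult: "\<eta> * (b - a) = e / 3"
    using \<eta>_def nonzero_eq_divide_eq by blast
  have "uniformly_continuous_on {a..b} g"
    using g by (intro compact_uniformly_continuous) auto
  then obtain d where d: "d > 0"
    "\<And>x y. x \<in> {a..b} \<Longrightarrow> y \<in> {a..b} \<Longrightarrow> \<bar>x - y\<bar> < d \<Longrightarrow> \<bar>g x - g y\<bar> < \<eta>"
    using \<eta> unfolding uniformly_continuous_on_def dist_real_def by metis
  have "(\<lambda>n. (b - a) / 2 ^ n) \<longlonglongrightarrow> 0" by real_asymp
  then have "\<forall>\<^sub>F n in sequentially. (b - a) / 2 ^ n < d"
    using d by (intro order_tendstoD)
  then show "\<forall>\<^sub>F n in sequentially.
      (\<integral>\<^sup>+x\<in>{a..<b}. ennreal \<bar>dyadic_mean n f a b x - f x\<bar> \<partial>lebesgue) < y"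
  proof eventually_elim
    case (elim n)
    have u: "\<bar>dyadic_mean n g a b x - g x\<bar> \<le> \<eta>" if "x \<in> {a..<b}" for x
      using that elim d(2) g \<open>a < b\<close> by (intro dyadic_mean_uniform) (auto intro!: less_imp_le)
    let ?I = "\<lambda>h. \<integral>\<^sup>+x\<in>{a..<b}. ennreal \<bar>h x\<bar> \<partial>lebesgue"
    have "?I (\<lambda>x. dyadic_mean n f a b x - f x) \<le>
        (\<integral>\<^sup>+x. ennreal \<bar>dyadic_mean n f a b x - dyadic_mean n g a b x\<bar> * indicator {a..<b} x +
          (ennreal \<eta> * indicator {a..<b} x + ennreal \<bar>f x - g x\<bar> * indicator {a..<b} x) \<partial>lebesgue)"
      using u \<eta> by (intro nn_integral_mono)
        (fastforce simp: indicator_def simp flip: ennreal_plus intro!: ennreal_leI)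
    also have "\<dots> = ?I (\<lambda>x. dyadic_mean n f a b x - dyadic_mean n g a b x) +
        (ennreal \<eta> * ennreal (b - a) + ?I (\<lambda>x. f x - g x))"
      using \<open>a < b\<close> by (simp add: nn_integral_add nn_integral_cmult_indicator emeasure_lebesgue_Ico)
    also have "\<dots> \<le> ?I (\<lambda>x. f x - g x) + (ennreal \<eta> * ennreal (b - a) + ?I (\<lambda>x. f x - g x))"
      by (intro add_right_mono nn_integral_dist_dyadic_mean f g \<open>a < b\<close>)
    also have "ennreal \<eta> * ennreal (b - a) = ennreal (e / 3)"
      using \<open>a < b\<close> \<eta> by (subst ennreal_mult[symmetric]) (simp_all add: \<eta>_mult)
    also have "?I (\<lambda>x. f x - g x) + (ennreal (e / 3) + ?I (\<lambda>x. f x - g x))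
        < ennreal (e / 3) + (ennreal (e / 3) + ennreal (e / 3))"
      by (intro add_strict_mono fg ennreal_add_left_cancel_less[THEN iffD2] conjI) (simp_all add: fg)
    also have "\<dots> = ennreal e" using e by (simp flip: ennreal_plus)
    finally show ?case using e by simp
  qed
qed simp

text \<open>L^1 convergence gives almost everywhere convergence along a subsequence, which is enough
  for Fatou; integrability of exp f is a consequence and not an assumption.\<close>

lemma exp_nn_integral_le:
  assumes f: "integrable lebesgue f" and "a < b"
    and bound: "\<And>n. (\<integral>\<^sup>+x\<in>{a..<b}. ennreal (exp (dyadic_mean n f a b x)) \<partial>lebesgue) \<le> K"
  shows "(\<integral>\<^sup>+x\<in>{a..<b}. ennreal (exp (f x)) \<partial>lebesgue) \<le> K"
proof -
  have [measurable]: "f \<in> borel_measurable lebesgue" using f by auto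
  have [measurable]: "{a..<b} \<in> sets lebesgue" by simp
  define D where "D n = (\<integral>\<^sup>+x\<in>{a..<b}. ennreal \<bar>dyadic_mean n f a b x - f x\<bar> \<partial>lebesgue)" for n
  have D: "D \<longlonglongrightarrow> 0" unfolding D_def by (rule dyadic_mean_tendsto_L1[OF f \<open>a < b\<close>])
  then have "\<forall>\<^sub>F n in sequentially. D n < 1" by (intro order_tendstoD) auto
  then obtain N where N: "\<And>n. n \<ge> N \<Longrightarrow> D n < 1" by (auto simp: eventually_sequentially)
  \<comment> \<open>The shift by N keeps the L^1 norms \<open>D (n + N)\<close> below 1, which
    provides the integrability required to extract the subsequence.\<close>
  define u where "u n x = indicator {a..<b} x * (dyadic_mean (n + N) f a b x - f x)" for n x
  have um [measurable]: "u n \<in> borel_measurable lebesgue" for n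
    unfolding u_def by measurable
  have uD: "(\<integral>\<^sup>+x. ennreal (norm (u n x)) \<partial>lebesgue) = D (n + N)" for n
    unfolding D_def u_def by (intro nn_integral_cong) (auto simp: indicator_def)
  have ui: "integrable lebesgue (u n)" for n
  proof (rule integrableI_bounded[OF um])
    show "(\<integral>\<^sup>+x. ennreal (norm (u n x)) \<partial>lebesgue) < \<infinity>"
      using less_trans[OF N[of "n + N"] ennreal_one_less_top] unfolding uD by simp
  qed
  have "(\<integral>x. norm (u n x) \<partial>lebesgue) = enn2real (D (n + N))" for n
    using ui by (subst uD[symmetric], subst integral_eq_nn_integral) auto
  moreover have "(\<lambda>n. enn2real (D (n + N))) \<longlonglongrightarrow> enn2real 0"
    using LIMSEQ_ignore_initial_segment[OF D, of N] by (intro tendsto_enn2real) auto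
  ultimately have "(\<lambda>n. \<integral>x. norm (u n x) \<partial>lebesgue) \<longlonglongrightarrow> 0" by simp
  from tendsto_L1_AE_subseq[OF ui this]
  obtain r :: "nat \<Rightarrow> nat" where r: "AE x in lebesgue. (\<lambda>n. u (r n) x) \<longlonglongrightarrow> 0" by blast
  define w where "w n x = ennreal (exp (dyadic_mean (r n + N) f a b x)) * indicator {a..<b} x" for n x
  have "AE x in lebesgue. ennreal (exp (f x)) * indicator {a..<b} x = liminf (\<lambda>n. w n x)"
    using r
  proof eventually_elim
    case (elim x)
    show ?case
    proof (cases "x \<in> {a..<b}")
      case True
      then have "(\<lambda>n. dyadic_mean (r n + N) f a b x) \<longlonglongrightarrow> f x"
        using elim by (simp add: u_def LIM_zero_iff)
      then have "(\<lambda>n. w n x) \<longlonglongrightarrow> ennreal (exp (f x)) * indicator {a..<b} x"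
        using True unfolding w_def by (auto intro!: tendsto_intros)
      then show ?thesis by (simp add: lim_imp_Liminf)
    qed (simp add: w_def Liminf_const)
  qed
  then have "(\<integral>\<^sup>+x\<in>{a..<b}. ennreal (exp (f x)) \<partial>lebesgue) = (\<integral>\<^sup>+x. liminf (\<lambda>n. w n x) \<partial>lebesgue)"
    by (rule nn_integral_cong_AE)
  also have "\<dots> \<le> liminf (\<lambda>n. \<integral>\<^sup>+x. w n x \<partial>lebesgue)"
    by (intro nn_integral_liminf) (simp add: w_def)
  also have "\<dots> \<le> limsup (\<lambda>n. \<integral>\<^sup>+x. w n x \<partial>lebesgue)"
    by (intro Liminf_le_Limsup) simp
  also have "\<dots> \<le> K"
    by (intro Limsup_bounded always_eventually allI) (simp add: w_def bound)
  finally show ?thesis .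
qed

section \<open>The Bellman function along dyadic splittings\<close>

definition variance :: "(real \<Rightarrow> real) \<Rightarrow> real \<Rightarrow> real \<Rightarrow> real" where
  "variance f a b = mean (\<lambda>x. (f x)\<^sup>2) a b - (mean f a b)\<^sup>2"

text \<open>With \<open>c = \<epsilon> / \<surd>2\<close>, the Bellman function at \<open>(\<langle>f\<rangle>, \<langle>f\<^sup>2\<rangle>)\<close> is \<open>exp \<langle>f\<rangle>\<close> times
  \<open>1 - expm1_sq p\<close>, normalised to be \<open>1\<close> at \<open>p = c\<close>; here \<open>p\<close> measures how far the variance
  stays below \<open>\<epsilon>\<^sup>2 = 2 c\<^sup>2\<close>.\<close>

definition slack :: "real \<Rightarrow> (real \<Rightarrow> real) \<Rightarrow> real \<Rightarrow> real \<Rightarrow> real" where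
  "slack c f a b = sqrt ((2 * c\<^sup>2 - variance f a b) / 2)"

text \<open>The variance of the whole is the average of the variances of the halves plus h^2. In
  terms of \<open>slack\<close> this is the constraint of \<open>dyadic_inequality\<close>; the
  common factor \<open>exp \<mu>\<close> splits off.\<close>

lemma bellman_split:
  assumes "a < b" and f: "integrable lebesgue f" "integrable lebesgue (\<lambda>x. (f x)\<^sup>2)"
  defines "m \<equiv> (a + b) / 2"
  assumes v: "variance f a b \<le> 2 * c\<^sup>2" "variance f a m \<le> 2 * c\<^sup>2" "variance f m b \<le> 2 * c\<^sup>2"
  shows "exp (mean f a m) * (1 - expm1_sq (slack c f a m)) + exp (mean f m b) * (1 - expm1_sq (slack c f m b))
    \<le> 2 * (exp (mean f a b) * (1 - expm1_sq (slack c f a b)))"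
proof -
  define h where "h = (mean f a m - mean f m b) / 2"
  define \<mu> where "\<mu> = mean f a b"
  have \<mu>: "mean f a m = \<mu> + h" "mean f m b = \<mu> + - h"
    using mean_split[OF \<open>a < b\<close> f(1)] by (simp_all add: \<mu>_def h_def m_def field_simps)
  have sq: "(slack c f x y)\<^sup>2 = (2 * c\<^sup>2 - variance f x y) / 2" "0 \<le> slack c f x y"
    if "variance f x y \<le> 2 * c\<^sup>2" for x y
    using that by (simp_all add: slack_def)
  have "(slack c f a m)\<^sup>2 + (slack c f m b)\<^sup>2 = 2 * (slack c f a b)\<^sup>2 + h\<^sup>2"
    using v mean_split[OF \<open>a < b\<close> f(2)]
    unfolding sq(1)[OF v(1)] sq(1)[OF v(2)] sq(1)[OF v(3)]
    by (simp add: variance_def \<mu> \<mu>_def[symmetric] m_def[symmetric] field_simps power2_eq_square)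
  from dyadic_inequality[OF sq(2) sq(2) sq(2) this] v
  have "exp \<mu> * (exp h * (1 - expm1_sq (slack c f a m)) + exp (-h) * (1 - expm1_sq (slack c f m b)))
      \<le> exp \<mu> * (2 * (1 - expm1_sq (slack c f a b)))"
    by (intro mult_left_mono) auto
  then show ?thesis unfolding \<mu> exp_add \<mu>_def[symmetric] by (simp add: algebra_simps)
qed

lemma expm1_sq_mono: "0 \<le> x \<Longrightarrow> x \<le> y \<Longrightarrow> expm1_sq x \<le> expm1_sq y"
  unfolding expm1_sq_def by (intro power_mono) auto

text \<open>Source of the threshold: the denominator \<open>1 - expm1_sq c\<close> of the constant
  vanishes at c = ln 2, that is at \<epsilon> = sqrt 2 ln 2.\<close>

lemma expm1_sq_less_1: "0 \<le> c \<Longrightarrow> c < ln 2 \<Longrightarrow> expm1_sq c < 1"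
proof -
  assume "0 \<le> c" "c < ln 2"
  then have "0 \<le> exp c - 1" "exp c - 1 < 1"
    using exp_less_mono[of c "ln 2"] by simp_all
  then show ?thesis unfolding expm1_sq_def by (simp add: power_less_one_iff)
qed

text \<open>P abstracts the lattice to a family of intervals closed under halving, so the induction
  hypothesis applies to both halves. Keeping the slack in the bound makes the induction close; at
  level 0 the slack is at most c because the variance is nonnegative.\<close>

lemma nn_integral_exp_dyadic_mean_le:
  assumes f: "integrable lebesgue f" "integrable lebesgue (\<lambda>x. (f x)\<^sup>2)"
    and c: "0 \<le> c" "c < ln 2"
    and P: "\<And>a b. P a b \<Longrightarrow> a < b \<and> variance f a b \<le> 2 * c\<^sup>2 \<and> P a ((a + b) / 2) \<and> P ((a + b) / 2) b"
    and "P a b"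
  shows "(\<integral>\<^sup>+x\<in>{a..<b}. ennreal (exp (dyadic_mean n f a b x)) \<partial>lebesgue)
    \<le> ennreal ((b - a) * (exp (mean f a b) * (1 - expm1_sq (slack c f a b))) / (1 - expm1_sq c))"
  using \<open>P a b\<close>
proof (induction n arbitrary: a b)
  case 0
  have v: "0 \<le> variance f a b" "a < b" "variance f a b \<le> 2 * c\<^sup>2"
    using P[OF 0] mean_square_ge[of a b f] f by (simp_all add: variance_def)
  have "slack c f a b \<le> sqrt (c\<^sup>2)"
    unfolding slack_def using v by (intro real_sqrt_le_mono) simp
  then have "expm1_sq (slack c f a b) \<le> expm1_sq c"
    using c v by (intro expm1_sq_mono) (auto simp: slack_def)
  then have "1 \<le> (1 - expm1_sq (slack c f a b)) / (1 - expm1_sq c)"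
    using expm1_sq_less_1[OF c] by simp
  then have "exp (mean f a b) * (b - a) * 1 \<le>
      exp (mean f a b) * (b - a) * ((1 - expm1_sq (slack c f a b)) / (1 - expm1_sq c))"
    using v by (intro mult_left_mono) auto
  moreover have "(\<integral>\<^sup>+x\<in>{a..<b}. ennreal (exp (dyadic_mean 0 f a b x)) \<partial>lebesgue) =
      ennreal (exp (mean f a b) * (b - a))"
    using v by (simp add: nn_integral_cmult_indicator emeasure_lebesgue_Ico ennreal_mult)
  ultimately show ?case by (simp add: ennreal_leI mult_ac)
next
  case (Suc n)
  let ?m = "(a + b) / 2"
  define B where "B a b = exp (mean f a b) * (1 - expm1_sq (slack c f a b))" for a b
  note Pab = P[OF Suc.prems]
  \<comment> \<open>Needed to merge the two \<open>ennreal\<close> bounds for the halves into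
    one.\<close>
  have nonneg: "0 \<le> (y - x) * B x y / (1 - expm1_sq c)" if "P x y" for x y
  proof -
    note P' = P[OF that]
    have "slack c f x y \<le> sqrt (c\<^sup>2)"
      unfolding slack_def using P' mean_square_ge[of x y f] f
      by (intro real_sqrt_le_mono) (simp add: variance_def)
    then have "expm1_sq (slack c f x y) \<le> expm1_sq c"
      using c P' by (intro expm1_sq_mono) (auto simp: slack_def)
    then show ?thesis
      using expm1_sq_less_1[OF c] P' by (simp add: B_def)
  qed
  have [measurable]: "dyadic_mean (Suc n) f a b \<in> borel_measurable lebesgue"
    by (rule borel_measurable_dyadic_mean_lebesgue)
  have "(\<integral>\<^sup>+x\<in>{a..<b}. ennreal (exp (dyadic_mean (Suc n) f a b x)) \<partial>lebesgue) =
      (\<integral>\<^sup>+x\<in>{a..<?m}. ennreal (exp (dyadic_mean (Suc n) f a b x)) \<partial>lebesgue) +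
      (\<integral>\<^sup>+x\<in>{?m..<b}. ennreal (exp (dyadic_mean (Suc n) f a b x)) \<partial>lebesgue)"
    using Pab by (intro nn_integral_Ico_split) (simp, measurable)
  also have "\<dots> = (\<integral>\<^sup>+x\<in>{a..<?m}. ennreal (exp (dyadic_mean n f a ?m x)) \<partial>lebesgue) +
      (\<integral>\<^sup>+x\<in>{?m..<b}. ennreal (exp (dyadic_mean n f ?m b x)) \<partial>lebesgue)"
    by (intro arg_cong2[where f = "(+)"] nn_integral_cong) (auto simp: indicator_def)
  also have "\<dots> \<le> ennreal ((?m - a) * B a ?m / (1 - expm1_sq c)) +
      ennreal ((b - ?m) * B ?m b / (1 - expm1_sq c))"
    using Pab unfolding B_def by (intro add_mono Suc.IH) auto
  also have "\<dots> = ennreal ((b - a) / 2 * (B a ?m + B ?m b) / (1 - expm1_sq c))"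
  proof -
    have "?m - a = (b - a) / 2" "b - ?m = (b - a) / 2" by (simp_all add: field_simps)
    then have "(?m - a) * B a ?m / (1 - expm1_sq c) + (b - ?m) * B ?m b / (1 - expm1_sq c) =
        (b - a) / 2 * (B a ?m + B ?m b) / (1 - expm1_sq c)"
      by (simp only: add_divide_distrib distrib_left)
    then show ?thesis using nonneg[of a ?m] nonneg[of ?m b] Pab by (simp flip: ennreal_plus)
  qed
  also have "\<dots> \<le> ennreal ((b - a) / 2 * (2 * B a b) / (1 - expm1_sq c))"
    using bellman_split[of a b f c] Pab P[of a ?m] P[of ?m b] f expm1_sq_less_1[OF c] unfolding B_def
    by (intro ennreal_leI divide_right_mono mult_left_mono) auto
  finally show ?case by (simp add: B_def)
qed

lemma nn_integral_exp_le:
  assumes f: "integrable lebesgue f" "integrable lebesgue (\<lambda>x. (f x)\<^sup>2)"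
    and c: "0 \<le> c" "c < ln 2"
    and P: "\<And>a b. P a b \<Longrightarrow> a < b \<and> variance f a b \<le> 2 * c\<^sup>2 \<and> P a ((a + b) / 2) \<and> P ((a + b) / 2) b"
    and "P a b"
  shows "(\<integral>\<^sup>+x\<in>{a..<b}. ennreal (exp (f x)) \<partial>lebesgue)
    \<le> ennreal ((b - a) * (exp (mean f a b) / (1 - expm1_sq c)))"
proof (rule exp_nn_integral_le[OF f(1)])
  show "a < b" using P \<open>P a b\<close> by blast
  fix n
  have "(\<integral>\<^sup>+x\<in>{a..<b}. ennreal (exp (dyadic_mean n f a b x)) \<partial>lebesgue)
    \<le> ennreal ((b - a) * (exp (mean f a b) * (1 - expm1_sq (slack c f a b))) / (1 - expm1_sq c))"
    using nn_integral_exp_dyadic_mean_le[OF f c P \<open>P a b\<close>] .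
  also have "\<dots> \<le> ennreal ((b - a) * (exp (mean f a b) * 1) / (1 - expm1_sq c))"
    using \<open>a < b\<close> expm1_sq_less_1[OF c]
    by (intro ennreal_leI divide_right_mono mult_left_mono) (auto simp: expm1_sq_def)
  finally show "(\<integral>\<^sup>+x\<in>{a..<b}. ennreal (exp (dyadic_mean n f a b x)) \<partial>lebesgue)
    \<le> ennreal ((b - a) * (exp (mean f a b) / (1 - expm1_sq c)))" by simp
qed

section \<open>Passage to the dyadic lattice\<close>

text \<open>The end points of a dyadic interval may or may not belong to it. Only their position is
  recorded, and integrals are moved to \<open>{a..<b}\<close> across a null set.\<close>

definition has_ends :: "real \<Rightarrow> real \<Rightarrow> real set \<Rightarrow> bool" where
  "has_ends a b J \<longleftrightarrow> a < b \<and> {a<..<b} \<subseteq> J \<and> J \<subseteq> {a..b}"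

lemma bounded_interval_has_ends:
  assumes "bounded_interval I"
  obtains a b where "has_ends a b I"
proof -
  have I: "is_interval I" "bounded I" "0 < measure lebesgue I"
    using assms by (auto simp: bounded_interval_def)
  have ne: "I \<noteq> {}" using I by auto
  have bdd: "bdd_above I" "bdd_below I"
    using I by (auto simp: bounded_imp_bdd_above bounded_imp_bdd_below)
  have sub: "I \<subseteq> {Inf I..Sup I}"
    using bdd by (auto intro: cInf_lower cSup_upper)
  have "Inf I \<le> Sup I" using ne sub by force
  moreover have "Inf I \<noteq> Sup I"
  proof
    assume "Inf I = Sup I"
    then obtain x where "I = {x}" using sub ne by (metis atLeastAtMost_singleton subset_singletonD)
    then show False using I(3) negligible_imp_measure0[OF negligible_sing[of x]] by simp
  qed
  moreover have "x \<in> I" if x: "Inf I < x" "x < Sup I" for x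
  proof -
    obtain y z where "y \<in> I" "y < x" "z \<in> I" "x < z"
      using cInf_lessD[OF ne x(1)] less_cSupD[OF ne x(2)] by blast
    then show ?thesis
      using I(1) by (meson is_interval_1 less_imp_le)
  qed
  ultimately show thesis using sub by (intro that[of "Inf I" "Sup I"]) (auto simp: has_ends_def)
qed

lemma midpoint_of_has_ends:
  assumes "has_ends a b J"
  shows "midpoint_of J = (a + b) / 2"
proof -
  have ne: "{a<..<b} \<noteq> {}" using assms by (auto simp: has_ends_def)
  have J: "a < b" "{a<..<b} \<subseteq> J" "J \<subseteq> {a..b}" using assms by (auto simp: has_ends_def)
  have bdd: "bdd_below J" "bdd_above J" using J(3) by (meson bdd_below_mono bdd_above_mono bdd_below_Icc bdd_above_Icc)+
  have "Inf J \<le> Inf {a<..<b}" using J ne bdd by (intro cInf_superset_mono)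
  moreover have "a \<le> Inf J" using J ne by (intro cInf_greatest) auto
  moreover have "Sup {a<..<b} \<le> Sup J" using J ne bdd by (intro cSup_subset_mono)
  moreover have "Sup J \<le> b" using J ne by (intro cSup_least) auto
  ultimately show ?thesis using J(1) by (simp add: midpoint_of_def)
qed

lemma has_ends_halves:
  assumes "has_ends a b J"
  shows "has_ends a ((a + b) / 2) (J \<inter> {..<midpoint_of J})"
    "has_ends ((a + b) / 2) b (J \<inter> {midpoint_of J..})"
  using assms unfolding midpoint_of_has_ends[OF assms]
  by (auto simp: has_ends_def subset_iff)

lemma dyadic_lattice_subset: "J \<in> dyadic_lattice I \<Longrightarrow> J \<subseteq> I"
  by (induction rule: dyadic_lattice.induct) auto

lemma sets_has_ends: "has_ends a b J \<Longrightarrow> J \<in> sets lebesgue"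
proof -
  assume J: "has_ends a b J"
  then have eq: "{a<..<b} \<union> (J \<inter> {a, b}) = J" by (force simp: has_ends_def)
  have "J \<inter> {a, b} \<in> sets borel" by (intro borel_closed finite_imp_closed) simp
  then have "{a<..<b} \<union> (J \<inter> {a, b}) \<in> sets borel" by (intro sets.Un) auto
  then have "J \<in> sets borel" unfolding eq .
  then show ?thesis by (simp add: sets_completionI_sets)
qed

lemma AE_has_ends:
  assumes "has_ends a b J"
  shows "AE x in lebesgue. x \<in> J \<longleftrightarrow> x \<in> {a..<b}"
proof -
  have "AE x in lebesgue. x \<noteq> y" for y :: real
    by (intro AE_completion AE_lborel_singleton)
  from this[of a] this[of b] show ?thesis
  proof eventually_elim
    case (elim x)
    then show ?case using assms by (force simp: has_ends_def subset_iff)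
  qed
qed

lemma emeasure_has_ends:
  assumes "has_ends a b J"
  shows "emeasure lebesgue J = ennreal (b - a)" "measure lebesgue J = b - a"
proof -
  have "a \<le> b" using assms by (simp add: has_ends_def)
  then show "emeasure lebesgue J = ennreal (b - a)"
    using emeasure_eq_AE[OF AE_has_ends[OF assms] sets_has_ends[OF assms]]
    by (simp add: emeasure_lebesgue_Ico)
  then show "measure lebesgue J = b - a"
    using \<open>a \<le> b\<close> by (simp add: measure_def)
qed

lemma nn_integral_has_ends:
  assumes "has_ends a b J"
  shows "(\<integral>\<^sup>+x\<in>J. f x \<partial>lebesgue) = (\<integral>\<^sup>+x\<in>{a..<b}. f x \<partial>lebesgue)"
  using AE_has_ends[OF assms] by (intro nn_integral_cong_AE) (auto simp: indicator_def)

lemma nn_average_has_ends: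
  assumes "has_ends a b J"
  shows "nn_average J f = (\<integral>\<^sup>+x\<in>{a..<b}. ennreal (f x) \<partial>lebesgue) / ennreal (b - a)"
  by (simp add: nn_average_def emeasure_has_ends[OF assms] nn_integral_has_ends[OF assms])

lemma average_has_ends:
  assumes J: "has_ends a b J" and [measurable]: "f \<in> borel_measurable lebesgue"
  shows "average J f = mean f a b"
proof -
  have [measurable]: "J \<in> sets lebesgue" "{a..<b} \<in> sets lebesgue"
    using sets_has_ends[OF J] by simp_all
  have "(LINT x:J|lebesgue. f x) = (LINT x:{a..<b}|lebesgue. f x)"
    unfolding set_lebesgue_integral_def
  proof (rule integral_cong_AE)
    show "AE x in lebesgue. indicat_real J x *\<^sub>R f x = indicat_real {a..<b} x *\<^sub>R f x"
      using AE_has_ends[OF J] by eventually_elim (auto simp: indicator_def)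
  qed measurable
  then show ?thesis by (simp add: average_def mean_def emeasure_has_ends[OF J])
qed

lemma oscillation_has_ends:
  assumes J: "has_ends a b J" and f: "integrable lebesgue f" "integrable lebesgue (\<lambda>x. (f x)\<^sup>2)"
  shows "oscillation J f = ereal (variance f a b)"
proof -
  have "a < b" using J by (simp add: has_ends_def)
  have "(\<integral>\<^sup>+x\<in>{a..<b}. ennreal ((f x)\<^sup>2) \<partial>lebesgue) = ennreal (LINT x:{a..<b}|lebesgue. (f x)\<^sup>2)"
    using set_integrable_lebesgue_Ico[OF f(2)] unfolding set_lebesgue_integral_def set_integrable_def
    by (subst nn_integral_eq_integral[symmetric])
      (auto intro!: nn_integral_cong simp: indicator_def)
  moreover have "0 \<le> (LINT x:{a..<b}|lebesgue. (f x)\<^sup>2)"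
    unfolding set_lebesgue_integral_def by (intro integral_nonneg_AE) auto
  ultimately have "nn_average J (\<lambda>x. (f x)\<^sup>2) = ennreal (mean (\<lambda>x. (f x)\<^sup>2) a b)"
    "0 \<le> mean (\<lambda>x. (f x)\<^sup>2) a b"
    using \<open>a < b\<close> by (simp_all add: nn_average_has_ends[OF J] divide_ennreal mean_def)
  moreover have "average J f = mean f a b"
    using f(1) by (intro average_has_ends J) auto
  ultimately show ?thesis by (simp add: oscillation_def variance_def)
qed

lemma oscillation_le_of_BMOd_ball:
  assumes "\<phi> \<in> BMOd_ball I \<epsilon>" "0 \<le> \<epsilon>" "J \<in> dyadic_lattice I"
  shows "oscillation J \<phi> \<le> ereal (\<epsilon>\<^sup>2)"
proof -
  let ?s = "sup_oscillation I \<phi>"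
  have s: "oscillation J \<phi> \<le> ?s" if "J \<in> dyadic_lattice I" for J
    using that by (auto simp: sup_oscillation_def intro: SUP_upper)
  have "?s \<le> ereal (\<epsilon>\<^sup>2)"
  proof (cases ?s)
    case (real r)
    then have "sqrt r \<le> \<epsilon>" using assms(1) by (simp add: BMOd_ball_def norm_BMOd_def)
    then have "r \<le> \<epsilon>\<^sup>2" by (rule sqrt_le_D)
    then show ?thesis using real by simp
  next
    \<comment> \<open>\<open>real_of_ereal\<close> sends \<infinity> to 0, so the norm bound says
      nothing here; membership in \<open>BMOd\<close> excludes the case.\<close>
    case PInf
    then show ?thesis using assms(1) by (simp add: BMOd_ball_def BMOd_def)
  qed simp
  with s[OF assms(3)] show ?thesis by (rule order_trans)
qed

lemma Cd_eq: "Cd \<epsilon> = 1 / (1 - expm1_sq (\<epsilon> / sqrt 2))"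
proof -
  have "1 - expm1_sq (\<epsilon> / sqrt 2) = exp (\<epsilon> / sqrt 2) * (2 - exp (\<epsilon> / sqrt 2))"
    by (simp add: expm1_sq_def power2_eq_square algebra_simps)
  then show ?thesis by (simp add: Cd_def exp_minus field_simps)
qed

lemma exp_inequality_Cd:
  assumes I: "has_ends a b I" and \<epsilon>: "0 \<le> \<epsilon>" "\<epsilon> < eps0d"
  shows "exp_inequality I \<epsilon> (Cd \<epsilon>)"
  unfolding exp_inequality_def
proof
  fix \<phi> assume \<phi>: "\<phi> \<in> BMOd_ball I \<epsilon>"
  \<comment> \<open>Cutting \<phi> off outside I makes it integrable on the whole line, as the
    results on dyadic means require, and changes no average over a subset of I.\<close>
  define f where "f x = indicator I x * \<phi> x" for x
  have f: "integrable lebesgue f"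
    using \<phi> by (simp add: f_def[abs_def] BMOd_ball_def BMOd_def set_integrable_def)
  have [measurable]: "f \<in> borel_measurable lebesgue" using f by auto
  have osc_f: "oscillation J \<phi> = oscillation J f" and avg_f: "average J \<phi> = average J f"
    and exp_f: "nn_average J (\<lambda>x. exp (\<phi> x)) = nn_average J (\<lambda>x. exp (f x))"
    if "J \<subseteq> I" for J
  proof -
    have eq: "f x = \<phi> x" if "x \<in> J" for x using that \<open>J \<subseteq> I\<close> by (auto simp: f_def)
    have nn: "nn_average J (\<lambda>x. g (\<phi> x)) = nn_average J (\<lambda>x. g (f x))" for g
      unfolding nn_average_def
      by (intro arg_cong2[where f = "(/)"] nn_integral_cong refl) (auto simp: indicator_def eq)
    show avg: "average J \<phi> = average J f"
      unfolding average_def set_lebesgue_integral_def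
      by (intro arg_cong2[where f = "(/)"] Bochner_Integration.integral_cong refl) (auto simp: indicator_def eq)
    show "oscillation J \<phi> = oscillation J f" "nn_average J (\<lambda>x. exp (\<phi> x)) = nn_average J (\<lambda>x. exp (f x))"
      by (simp_all add: oscillation_def avg nn[of "\<lambda>y. y\<^sup>2"] nn[of exp])
  qed
  have "a < b" using I by (simp add: has_ends_def)
  have "oscillation I f \<le> ereal (\<epsilon>\<^sup>2)"
    using oscillation_le_of_BMOd_ball[OF \<phi> \<epsilon>(1) dyadic_lattice.root] osc_f by simp
  \<comment> \<open>Square integrability is not part of \<phi> \<in> L^1: it comes from the root of
    the lattice, where an infinite mean square would make the oscillation infinite.\<close>
  then have "nn_average I (\<lambda>x. (f x)\<^sup>2) \<noteq> \<infinity>"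
    by (auto simp: oscillation_def)
  then have "(\<integral>\<^sup>+x\<in>I. ennreal ((f x)\<^sup>2) \<partial>lebesgue) \<noteq> \<infinity>"
    using \<open>a < b\<close> by (auto simp: nn_average_def emeasure_has_ends[OF I] ennreal_top_divide)
  moreover have "(\<integral>\<^sup>+x\<in>I. ennreal ((f x)\<^sup>2) \<partial>lebesgue) = (\<integral>\<^sup>+x. ennreal (norm ((f x)\<^sup>2)) \<partial>lebesgue)"
    by (intro nn_integral_cong) (auto simp: f_def indicator_def)
  ultimately have f2: "integrable lebesgue (\<lambda>x. (f x)\<^sup>2)"
    by (intro integrableI_bounded) (auto simp: less_top)
  define c where "c = \<epsilon> / sqrt 2"
  have c: "0 \<le> c" "c < ln 2" "2 * c\<^sup>2 = \<epsilon>\<^sup>2"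
    using \<epsilon> by (auto simp: c_def eps0d_def field_simps)
  define P where "P x y \<longleftrightarrow> (\<exists>J\<in>dyadic_lattice I. has_ends x y J)" for x y
  have P: "x < y \<and> variance f x y \<le> 2 * c\<^sup>2 \<and> P x ((x + y) / 2) \<and> P ((x + y) / 2) y" if xy: "P x y" for x y
  proof -
    obtain J where J: "J \<in> dyadic_lattice I" "has_ends x y J" using xy by (auto simp: P_def)
    have "ereal (variance f x y) \<le> ereal (\<epsilon>\<^sup>2)"
      using oscillation_le_of_BMOd_ball[OF \<phi> \<epsilon>(1) J(1)] osc_f[OF dyadic_lattice_subset[OF J(1)]]
        oscillation_has_ends[OF J(2) f f2] by simp
    then show ?thesis
      using J c(3) has_ends_halves[OF J(2)] dyadic_lattice.intros(2,3)[OF J(1)]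
      by (auto simp: P_def has_ends_def[of x y])
  qed
  have "P a b" using I dyadic_lattice.root by (auto simp: P_def)
  have "nn_average I (\<lambda>x. exp (f x)) \<le> ennreal ((b - a) * (exp (mean f a b) / (1 - expm1_sq c))) / ennreal (b - a)"
    unfolding nn_average_has_ends[OF I]
    by (intro divide_right_mono_ennreal nn_integral_exp_le[OF f f2 c(1,2) P \<open>P a b\<close>])
  also have "\<dots> = ennreal (exp (mean f a b) / (1 - expm1_sq c))"
    using \<open>a < b\<close> expm1_sq_less_1[OF c(1,2)] by (subst divide_ennreal) (auto intro!: mult_nonneg_nonneg)
  also have "mean f a b = average I \<phi>"
    using average_has_ends[OF I, of f] avg_f by simp
  finally show "nn_average I (\<lambda>x. exp (\<phi> x)) \<le> ennreal (Cd \<epsilon> * exp (average I \<phi>))"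
    using exp_f by (simp add: Cd_eq c_def)
qed

section \<open>Sharpness\<close>

text \<open>On \<open>[a + (b - a) / 2\<^sup>k\<^sup>+\<^sup>1, a + (b - a) / 2\<^sup>k)\<close> the step index is \<open>k\<close>.\<close>

definition node :: "real \<Rightarrow> real \<Rightarrow> nat \<Rightarrow> real" where
  "node a b k = a + (b - a) / 2 ^ k"

text \<open>The closed formula gives measurability at once. For (x - a)/(b - a) in [2^-(k+1), 2^-k)
  the ceiling is k + 1, hence the subtraction of 1.\<close>

definition step_index :: "real \<Rightarrow> real \<Rightarrow> real \<Rightarrow> nat" where
  "step_index a b x = nat \<lceil>- log 2 ((x - a) / (b - a))\<rceil> - 1"

lemma measurable_step_index [measurable]: "step_index a b \<in> measurable borel (count_space UNIV)"
  unfolding step_index_def by measurable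

lemma measurable_step_index_lebesgue [measurable]:
  "step_index a b \<in> measurable lebesgue (count_space UNIV)"
  using measurable_step_index[of a b] by (simp add: measurable_completion)

lemma step_index_eq:
  assumes "a < b" "node a b (Suc k) \<le> x" "x < node a b k"
  shows "step_index a b x = k"
proof -
  let ?t = "(x - a) / (b - a)"
  have p: "2 powr (- real n) = 1 / 2 ^ n" for n
    by (simp only: powr_minus powr_realpow[of "2::real", simplified]) (simp add: inverse_eq_divide)
  have t: "2 powr (- real (Suc k)) \<le> ?t" "?t < 2 powr (- real k)"
    using assms unfolding p by (auto simp: node_def field_simps)
  have "0 < ?t" using t(1) by (rule less_le_trans[rotated]) simp
  have "- real (Suc k) \<le> log 2 ?t"
    using t(1) \<open>0 < ?t\<close> by (simp add: le_log_iff)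
  moreover have "log 2 ?t < - real k"
    using t(2) \<open>0 < ?t\<close> by (simp add: log_less_iff)
  ultimately have "\<lceil>- log 2 ?t\<rceil> = int (Suc k)"
    by (intro ceiling_unique) auto
  then show ?thesis by (simp add: step_index_def)
qed

lemma node_less: "a < b \<Longrightarrow> a < node a b k"
  by (simp add: node_def)

lemma node_Suc_less: "a < b \<Longrightarrow> node a b (Suc k) < node a b k"
  by (simp add: node_def field_simps)

lemma node_mono: "a < b \<Longrightarrow> j \<le> k \<Longrightarrow> node a b k \<le> node a b j"
  by (simp add: node_def divide_left_mono power_increasing)

lemma UN_steps:
  assumes "a < b"
  shows "(\<Union>k. {node a b (Suc (m + k))..<node a b (m + k)}) = {a<..<node a b m}"
proof (intro equalityI subsetI)
  fix x assume "x \<in> (\<Union>k. {node a b (Suc (m + k))..<node a b (m + k)})"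
  then obtain k where "node a b (Suc (m + k)) \<le> x" "x < node a b (m + k)" by auto
  then show "x \<in> {a<..<node a b m}"
    using node_less[OF assms, of "Suc (m + k)"] node_mono[OF assms, of m "m + k"] by simp
next
  fix x assume x: "x \<in> {a<..<node a b m}"
  have "(\<lambda>k. node a b k) \<longlonglongrightarrow> a" unfolding node_def by real_asymp
  then have "\<forall>\<^sub>F k in sequentially. node a b k < x" using x by (intro order_tendstoD) auto
  then obtain K where K: "node a b K < x" by (auto simp: eventually_sequentially)
  define j where "j = (LEAST k. node a b k \<le> x)"
  have j: "node a b j \<le> x"
    unfolding j_def by (rule LeastI[of "\<lambda>k. node a b k \<le> x" K]) (use K in simp)
  have "m < j"
  proof (rule ccontr)
    assume "\<not> m < j"
    then have "node a b m \<le> node a b j" by (intro node_mono assms) simp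
    then show False using x j by simp
  qed
  then obtain k where k: "j = Suc (m + k)" using less_imp_Suc_add by blast
  have "\<not> node a b (m + k) \<le> x"
    using not_less_Least[of "m + k" "\<lambda>k. node a b k \<le> x"] k by (simp add: j_def)
  then show "x \<in> (\<Union>k. {node a b (Suc (m + k))..<node a b (m + k)})"
    using j k by auto
qed

lemma nn_integral_steps:
  assumes "a < b"
  shows "(\<integral>\<^sup>+x\<in>{a..<node a b m}. g (step_index a b x) \<partial>lebesgue) =
    (\<Sum>k. g (m + k) * ennreal ((b - a) / 2 ^ m / 2 ^ Suc k))"
proof -
  let ?B = "\<lambda>k. {node a b (Suc (m + k))..<node a b (m + k)}"
  have disj: "disjoint_family ?B"
  unfolding disjoint_family_on_def
  proof (intro ballI impI)
    fix i j :: nat assume "i \<noteq> j"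
    then show "?B i \<inter> ?B j = {}"
      using node_mono[OF assms, of "Suc (m + i)" "m + j"] node_mono[OF assms, of "Suc (m + j)" "m + i"]
      by (cases "i < j") auto
  qed
  have "AE x in lebesgue. x \<noteq> a"
    by (intro AE_completion AE_lborel_singleton)
  then have "AE x in lebesgue. g (step_index a b x) * indicator {a..<node a b m} x =
      g (step_index a b x) * indicator (\<Union>k. ?B k) x"
    unfolding UN_steps[OF assms] by eventually_elim (auto simp: indicator_def)
  then have "(\<integral>\<^sup>+x\<in>{a..<node a b m}. g (step_index a b x) \<partial>lebesgue) =
      (\<integral>\<^sup>+x\<in>(\<Union>k. ?B k). g (step_index a b x) \<partial>lebesgue)"
    by (rule nn_integral_cong_AE)
  also have "\<dots> = (\<Sum>k. \<integral>\<^sup>+x\<in>?B k. g (step_index a b x) \<partial>lebesgue)"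
  proof (rule nn_integral_disjoint_family[OF _ _ disj])
    show "(\<lambda>x. g (step_index a b x)) \<in> borel_measurable lebesgue"
      by (rule measurable_compose[OF measurable_step_index_lebesgue]) simp
  qed simp
  also have "(\<lambda>k. \<integral>\<^sup>+x\<in>?B k. g (step_index a b x) \<partial>lebesgue) = (\<lambda>k. g (m + k) * ennreal ((b - a) / 2 ^ m / 2 ^ Suc k))"
  proof
    fix k
    have "(\<integral>\<^sup>+x\<in>?B k. g (step_index a b x) \<partial>lebesgue) = (\<integral>\<^sup>+x\<in>?B k. g (m + k) \<partial>lebesgue)"
      using step_index_eq[OF assms] by (intro nn_integral_cong) (auto simp: indicator_def)
    also have "\<dots> = g (m + k) * ennreal (node a b (m + k) - node a b (Suc (m + k)))"
      using node_Suc_less[OF assms, of "m + k"]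
      by (simp add: nn_integral_cmult_indicator emeasure_lebesgue_Ico)
    also have "node a b (m + k) - node a b (Suc (m + k)) = (b - a) / 2 ^ m / 2 ^ Suc k"
      by (simp add: node_def power_add field_simps)
    finally show "(\<integral>\<^sup>+x\<in>?B k. g (step_index a b x) \<partial>lebesgue) =
        g (m + k) * ennreal ((b - a) / 2 ^ m / 2 ^ Suc k)" .
  qed
  finally show ?thesis .
qed

lemma nn_integral_steps_sums:
  assumes "a < b" "\<And>n. 0 \<le> r n" "(\<lambda>k. r (m + k) / 2 ^ Suc k) sums s"
  shows "(\<integral>\<^sup>+x\<in>{a..<node a b m}. ennreal (r (step_index a b x)) \<partial>lebesgue) =
    ennreal (s * (node a b m - a))"
proof -
  have "(\<lambda>k. r (m + k) / 2 ^ Suc k * ((b - a) / 2 ^ m)) sums (s * ((b - a) / 2 ^ m))"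
    by (rule sums_mult2[OF assms(3)])
  then have "(\<Sum>k. ennreal (r (m + k) / 2 ^ Suc k * ((b - a) / 2 ^ m))) = ennreal (s * ((b - a) / 2 ^ m))"
    using assms(1,2) by (intro suminf_ennreal_eq) auto
  moreover have "ennreal (r (m + k)) * ennreal ((b - a) / 2 ^ m / 2 ^ Suc k) =
      ennreal (r (m + k) / 2 ^ Suc k * ((b - a) / 2 ^ m))" for k
    using assms(1,2) by (subst ennreal_mult[symmetric]) (auto simp: field_simps)
  ultimately show ?thesis
    using nn_integral_steps[OF assms(1), of "\<lambda>n. ennreal (r n)" m] by (simp add: node_def)
qed

section \<open>Moments and oscillation of the extremal staircase\<close>

lemma sums_index: "(\<lambda>k. c * real (m + k) / 2 ^ Suc k) sums (c * (real m + 1))"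
proof -
  \<comment> \<open>\<open>?u k\<close> is the tail of the series from index k on, so the terms are
    its differences.\<close>
  let ?u = "\<lambda>k. c * (real (m + k) + 1) / 2 ^ k"
  have "(\<lambda>k. ?u k - ?u (Suc k)) sums (?u 0 - 0)"
    by (rule telescope_sums') real_asymp
  moreover have "?u k - ?u (Suc k) = c * real (m + k) / 2 ^ Suc k" for k
    by (simp add: field_simps)
  ultimately show ?thesis by simp
qed

lemma sums_index_square:
  "(\<lambda>k. (c * real (m + k))\<^sup>2 / 2 ^ Suc k) sums (c\<^sup>2 * ((real m + 1)\<^sup>2 + 2))"
proof -
  \<comment> \<open>Again the tail; with n = m + k the identity behind it is 2 ((n+1)^2 + 2) -
    ((n+2)^2 + 2) = n^2.\<close>
  let ?u = "\<lambda>k. c\<^sup>2 * ((real (m + k) + 1)\<^sup>2 + 2) / 2 ^ k"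
  have "(\<lambda>k. ?u k - ?u (Suc k)) sums (?u 0 - 0)"
    by (rule telescope_sums') real_asymp
  moreover have "?u k - ?u (Suc k) = (c * real (m + k))\<^sup>2 / 2 ^ Suc k" for k
    by (simp add: field_simps power2_eq_square)
  ultimately show ?thesis by simp
qed

lemma sums_exp_index:
  assumes "c < ln 2"
  shows "(\<lambda>k. exp (c * real (0 + k)) / 2 ^ Suc k) sums (1 / (2 - exp c))"
proof -
  have "exp c < 2" using exp_less_mono[OF assms] by simp
  then have "(\<lambda>k. 1 / 2 * (exp c / 2) ^ k) sums (1 / 2 * (1 / (1 - exp c / 2)))"
    by (intro sums_mult geometric_sums) simp
  moreover have "(\<lambda>k. 1 / 2 * (exp c / 2) ^ k) = (\<lambda>k. exp (c * real (0 + k)) / 2 ^ Suc k)"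
    by (simp add: power_divide mult.commute[of c] exp_of_nat_mult)
  moreover have "1 / 2 * (1 / (1 - exp c / 2)) = 1 / (2 - exp c)"
    using \<open>exp c < 2\<close> by (simp add: field_simps)
  ultimately show ?thesis by metis
qed

definition staircase :: "real \<Rightarrow> real \<Rightarrow> real \<Rightarrow> real \<Rightarrow> real" where
  "staircase a b c x = c * real (step_index a b x)"

lemma borel_measurable_staircase [measurable]: "staircase a b c \<in> borel_measurable lebesgue"
proof -
  have "(\<lambda>x. real (step_index a b x)) \<in> borel_measurable lebesgue"
    by (rule measurable_compose[OF measurable_step_index_lebesgue]) simp
  then show ?thesis unfolding staircase_def [abs_def] by (rule borel_measurable_times[rotated]) simp
qed

context
  fixes a b c :: real
  assumes ab: "a < b" and c: "0 \<le> c"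
begin

lemma staircase_nonneg: "0 \<le> staircase a b c x"
  using c by (simp add: staircase_def)

lemma nn_integral_staircase:
  "(\<integral>\<^sup>+x\<in>{a..<node a b m}. ennreal (staircase a b c x) \<partial>lebesgue) =
    ennreal (c * (real m + 1) * (node a b m - a))"
  using nn_integral_steps_sums[OF ab _ sums_index, of c m] c by (simp add: staircase_def)

lemma mean_staircase: "mean (staircase a b c) a (node a b m) = c * (real m + 1)"
proof -
  have [measurable]: "{a..<node a b m} \<in> sets lebesgue" by simp
  have meas: "(\<lambda>x. indicat_real {a..<node a b m} x *\<^sub>R staircase a b c x) \<in> borel_measurable lebesgue"
    by measurable
  have "(LINT x:{a..<node a b m}|lebesgue. staircase a b c x) =
      enn2real (\<integral>\<^sup>+x\<in>{a..<node a b m}. ennreal (staircase a b c x) \<partial>lebesgue)"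
    unfolding set_lebesgue_integral_def using staircase_nonneg
    by (subst integral_eq_nn_integral[OF meas])
      (auto intro!: nn_integral_cong arg_cong[where f = enn2real] simp: indicator_def)
  also have "\<dots> = c * (real m + 1) * (node a b m - a)"
    using c node_less[OF ab, of m] by (simp add: nn_integral_staircase)
  finally show ?thesis using node_less[OF ab, of m] by (simp add: mean_def)
qed

text \<open>On a leftmost interval the staircase is a rescaled copy of itself plus c m, so its
  variance does not depend on m; the summand 2 in \<open>sums_index_square\<close> is the variance
  of the index.\<close>

lemma oscillation_staircase_node:
  assumes "has_ends a (node a b m) J"
  shows "oscillation J (staircase a b c) = ereal (2 * c\<^sup>2)"
proof -
  have n: "0 < node a b m - a" using node_less[OF ab, of m] by simp
  have "nn_average J (\<lambda>x. (staircase a b c x)\<^sup>2) = ennreal (c\<^sup>2 * ((real m + 1)\<^sup>2 + 2))"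
    using nn_integral_steps_sums[OF ab _ sums_index_square, of c m] n
    unfolding nn_average_has_ends[OF assms] staircase_def
    by (simp add: divide_ennreal)
  moreover have "average J (staircase a b c) = c * (real m + 1)"
    using average_has_ends[OF assms borel_measurable_staircase] by (simp add: mean_staircase)
  ultimately show ?thesis
    unfolding oscillation_def by (simp only: enn2ereal_ennreal[OF mult_nonneg_nonneg] zero_le_power2
        add_nonneg_nonneg zero_le_numeral) (simp add: power2_eq_square algebra_simps)
qed

lemma oscillation_staircase_step:
  assumes J: "has_ends x y J" and xy: "node a b (Suc m) \<le> x" "y \<le> node a b m"
  shows "oscillation J (staircase a b c) = 0"
proof -
  have "x < y" using J by (simp add: has_ends_def)
  have eq: "staircase a b c z = c * real m" if "z \<in> {x..<y}" for z
    using that xy step_index_eq[OF ab, of m z] by (simp add: staircase_def)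
  have "(\<integral>\<^sup>+z\<in>{x..<y}. ennreal ((staircase a b c z)\<^sup>2) \<partial>lebesgue) =
      (\<integral>\<^sup>+z\<in>{x..<y}. ennreal ((c * real m)\<^sup>2) \<partial>lebesgue)"
    by (intro nn_integral_cong) (auto simp: indicator_def eq)
  also have "\<dots> = ennreal ((c * real m)\<^sup>2 * (y - x))"
    using \<open>x < y\<close> by (simp add: nn_integral_cmult_indicator emeasure_lebesgue_Ico ennreal_mult)
  finally have "nn_average J (\<lambda>x. (staircase a b c x)\<^sup>2) = ennreal ((c * real m)\<^sup>2)"
    unfolding nn_average_has_ends[OF J] using \<open>x < y\<close> by (simp add: divide_ennreal)
  moreover have "(LINT z:{x..<y}|lebesgue. staircase a b c z) = (LINT z:{x..<y}|lebesgue. c * real m)"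
    by (intro set_lebesgue_integral_cong) (auto simp: eq)
  then have "average J (staircase a b c) = c * real m"
    using average_has_ends[OF J borel_measurable_staircase] \<open>x < y\<close>
    by (simp add: mean_def set_integral_Ico_const)
  ultimately show ?thesis by (simp add: oscillation_def)
qed

text \<open>Halving a leftmost interval yields the next leftmost interval and one full step; all
  descendants of a step stay inside it, where the staircase is constant.\<close>

lemma dyadic_lattice_cases:
  assumes "J \<in> dyadic_lattice I" and I: "has_ends a b I"
  shows "(\<exists>m. has_ends a (node a b m) J) \<or>
    (\<exists>m x y. has_ends x y J \<and> node a b (Suc m) \<le> x \<and> y \<le> node a b m)"
  using assms(1)
proof (induction rule: dyadic_lattice.induct)
  case root
  have "has_ends a (node a b 0) I" using I by (simp add: node_def)
  then show ?case by blast
next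
  case (left_half J)
  then show ?case
  proof (elim disjE exE conjE)
    fix m assume "has_ends a (node a b m) J"
    moreover have "(a + node a b m) / 2 = node a b (Suc m)" by (simp add: node_def field_simps)
    ultimately show ?thesis using has_ends_halves(1) by metis
  next
    fix m x y assume *: "has_ends x y J" "node a b (Suc m) \<le> x" "y \<le> node a b m"
    then have "(x + y) / 2 \<le> node a b m" by (simp add: has_ends_def)
    then show ?thesis using has_ends_halves(1)[OF *(1)] * by blast
  qed
next
  case (right_half J)
  then show ?case
  proof (elim disjE exE conjE)
    fix m assume J: "has_ends a (node a b m) J"
    have "(a + node a b m) / 2 = node a b (Suc m)" by (simp add: node_def field_simps)
    then show ?thesis using has_ends_halves(2)[OF J] by (metis order_refl)
  next
    fix m x y assume *: "has_ends x y J" "node a b (Suc m) \<le> x" "y \<le> node a b m"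
    then have "node a b (Suc m) \<le> (x + y) / 2" by (simp add: has_ends_def)
    then show ?thesis using has_ends_halves(2)[OF *(1)] * by blast
  qed
qed

lemma staircase_in_BMOd_ball:
  assumes I: "has_ends a b I"
  shows "staircase a b c \<in> BMOd_ball I (sqrt 2 * c)"
proof -
  have [measurable]: "I \<in> sets lebesgue" using sets_has_ends[OF I] .
  have "(\<integral>\<^sup>+x. ennreal (norm (indicator I x *\<^sub>R staircase a b c x)) \<partial>lebesgue) =
      (\<integral>\<^sup>+x\<in>I. ennreal (staircase a b c x) \<partial>lebesgue)"
    using staircase_nonneg by (intro nn_integral_cong) (auto simp: indicator_def)
  also have "\<dots> < \<infinity>"
    using nn_integral_staircase[of 0] by (simp add: nn_integral_has_ends[OF I] node_def)
  finally have "set_integrable lebesgue I (staircase a b c)"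
    unfolding set_integrable_def by (intro integrableI_bounded) measurable
  moreover have le: "sup_oscillation I (staircase a b c) \<le> ereal (2 * c\<^sup>2)"
    unfolding sup_oscillation_def
    using dyadic_lattice_cases[OF _ I] oscillation_staircase_node oscillation_staircase_step
    by (intro SUP_least) fastforce
  moreover have "norm_BMOd I (staircase a b c) \<le> sqrt (2 * c\<^sup>2)"
    unfolding norm_BMOd_def using le
    by (intro real_sqrt_le_mono) (cases "sup_oscillation I (staircase a b c)"; simp)
  moreover have "sqrt (2 * c\<^sup>2) = sqrt 2 * c" using c by (simp add: real_sqrt_mult)
  ultimately show ?thesis by (auto simp: BMOd_ball_def BMOd_def)
qed

lemma average_staircase: "has_ends a b I \<Longrightarrow> average I (staircase a b c) = c"
  using average_has_ends[of a b I, OF _ borel_measurable_staircase] mean_staircase[of 0]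
  by (simp add: node_def)

lemma nn_average_exp_staircase:
  assumes I: "has_ends a b I" and "c < ln 2"
  shows "nn_average I (\<lambda>x. exp (staircase a b c x)) = ennreal (1 / (2 - exp c))"
proof -
  have "exp c < 2" using exp_less_mono[OF \<open>c < ln 2\<close>] by simp
  then show ?thesis
    using nn_integral_steps_sums[OF ab _ sums_exp_index[OF \<open>c < ln 2\<close>]] ab
    unfolding nn_average_has_ends[OF I] staircase_def
    by (simp add: node_def divide_ennreal)
qed

text \<open>Step k has length (b - a)/2^(k+1) and the exponential equals 2^k on it, so every step
  contributes the same amount (b - a)/2.\<close>

lemma nn_average_exp_staircase_ln_2:
  assumes I: "has_ends a b I" and "c = ln 2"
  shows "nn_average I (\<lambda>x. exp (staircase a b c x)) = \<infinity>"
proof -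
  have "exp (c * real k) = 2 ^ k" for k
    using \<open>c = ln 2\<close> by (simp add: mult.commute[of _ "real k"] exp_of_nat_mult)
  then have "ennreal (exp (c * real (0 + k))) * ennreal ((b - a) / 2 ^ 0 / 2 ^ Suc k) = ennreal ((b - a) / 2)" for k
    by (subst ennreal_mult[symmetric]) (use ab in auto)
  then have "(\<integral>\<^sup>+x\<in>{a..<b}. ennreal (exp (staircase a b c x)) \<partial>lebesgue) = (\<Sum>k::nat. ennreal ((b - a) / 2))"
    using nn_integral_steps[OF ab, of "\<lambda>n. ennreal (exp (c * real n))" 0]
    by (simp only: staircase_def) (simp add: node_def)
  also have "\<dots> = (SUP n. of_nat n) * ennreal ((b - a) / 2)"
    by (simp add: suminf_eq_SUP SUP_mult_right_ennreal)
  also have "\<dots> = \<infinity>" using ab by (simp add: ennreal_SUP_of_nat_eq_top ennreal_top_mult)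
  finally show ?thesis using ab by (simp add: nn_average_has_ends[OF I] ennreal_top_divide)
qed

end

theorem mainTheorem2:
  fixes I :: "real set"
  assumes "bounded_interval I"
  shows "(\<forall>\<epsilon>. 0 \<le> \<epsilon> \<and> \<epsilon> < eps0d \<longrightarrow> exp_inequality I \<epsilon> (Cd \<epsilon>))
    \<and> ((\<forall>\<epsilon>. 0 \<le> \<epsilon> \<and> \<epsilon> < eps0d \<longrightarrow> (\<exists>C. exp_inequality I \<epsilon> C))
        \<and> (\<forall>E. (\<forall>\<epsilon>. 0 \<le> \<epsilon> \<and> \<epsilon> < E \<longrightarrow> (\<exists>C. exp_inequality I \<epsilon> C)) \<longrightarrow> E \<le> eps0d))
    \<and> (\<forall>\<epsilon>. 0 \<le> \<epsilon> \<and> \<epsilon> < eps0d \<longrightarrow>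
        exp_inequality I \<epsilon> (Cd \<epsilon>) \<and> (\<forall>C. exp_inequality I \<epsilon> C \<longrightarrow> Cd \<epsilon> \<le> C))"
proof -
  obtain a b where I: "has_ends a b I" using bounded_interval_has_ends[OF assms] .
  then have ab: "a < b" by (simp add: has_ends_def)
  have upper: "exp_inequality I \<epsilon> (Cd \<epsilon>)" if "0 \<le> \<epsilon> \<and> \<epsilon> < eps0d" for \<epsilon>
    using exp_inequality_Cd[OF I] that by blast
  have "E \<le> eps0d" if E: "\<forall>\<epsilon>. 0 \<le> \<epsilon> \<and> \<epsilon> < E \<longrightarrow> (\<exists>C. exp_inequality I \<epsilon> C)" for E
  proof (rule ccontr)
    assume "\<not> E \<le> eps0d"
    moreover have "0 \<le> eps0d" by (simp add: eps0d_def)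
    \<comment> \<open>The inequality already fails at \<epsilon> = \<open>eps0d\<close> itself, for
      every C, so E cannot lie beyond it.\<close>
    ultimately obtain C where "exp_inequality I eps0d C" using E by force
    moreover have "staircase a b (ln 2) \<in> BMOd_ball I eps0d"
      using staircase_in_BMOd_ball[OF ab _ I, of "ln 2"] by (simp add: eps0d_def)
    ultimately have "nn_average I (\<lambda>x. exp (staircase a b (ln 2) x)) < \<infinity>"
      by (auto simp: exp_inequality_def intro: le_less_trans)
    then show False using nn_average_exp_staircase_ln_2[OF ab _ I refl] by simp
  qed
  moreover have "Cd \<epsilon> \<le> C" if \<epsilon>: "0 \<le> \<epsilon> \<and> \<epsilon> < eps0d" and C: "exp_inequality I \<epsilon> C" for \<epsilon> C
  proof -
    define c where "c = \<epsilon> / sqrt 2"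
    have c: "0 \<le> c" "c < ln 2" "sqrt 2 * c = \<epsilon>"
      using \<epsilon> by (auto simp: c_def eps0d_def field_simps)
    have pos: "0 < 2 - exp c" using exp_less_mono[OF c(2)] by simp
    have "ennreal (1 / (2 - exp c)) \<le> ennreal (C * exp c)"
      using C staircase_in_BMOd_ball[OF ab c(1) I] c(3) average_staircase[OF ab c(1) I]
        nn_average_exp_staircase[OF ab c(1) I c(2)]
      by (auto simp: exp_inequality_def)
    \<comment> \<open>\<open>ennreal\<close> sends negative reals to 0; positivity of the left side
      excludes a negative C.\<close>
    then have "1 / (2 - exp c) \<le> C * exp c"
      using pos by (subst (asm) ennreal_le_iff2) (auto simp: field_simps)
    then have "exp (- c) * (1 / (2 - exp c)) \<le> exp (- c) * (C * exp c)"
      by (intro mult_left_mono) auto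
    also have "exp (- c) * (C * exp c) = C" by (simp add: exp_minus)
    finally show ?thesis by (simp add: Cd_def c_def)
  qed
  ultimately show ?thesis using upper by blast
qed

end
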